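(* Let $p$ be a positive integer and let $\phi,\psi$ be nonzero radial functions. If $T_{e^{ip\theta}\phi}$ commutes with $T_{e^{-ip\theta}\psi}$ on $L^2_h$, then $p=1$ and $\phi,\psi$ satisfy the Mellin convolution equation $$\phi\ast_M\psi=C\left(\frac{1}{r}-r\right)$$ for some constant $C$.
   Context: Let $\mathbb{D}$ be the open unit disk in $\mathbb{C}$, with normalized Lebesgue area measure $dA=\frac{1}{\pi}r\,dr\,d\theta$ in polar coordinates $(r,\theta)$. The harmonic Bergman space $L^2_h$ is the closed subspace of $L^2(\mathbb{D},dA)$ consisting of all (complex-valued) harmonic functions on $\mathbb{D}$ belonging to $L^2(\mathbb{D},dA)$. Let $R_z$ denote the reproducing kernel of $L^2_h$ at $z\in\mathbb{D}$. For $f\in L^1(\mathbb{D},dA)$, the Toeplitz operator $T_f$ with symbol $f$ is densely defined on $L^2_h$ by $(T_fu)(z)=\int_{\mathbb{D}}f(w)u(w)R_z(w)\,dA(w)$ for $u$ a harmonic polynomial (a finite linear combination of $z^n,\bar z^n$, $n\ge 0$). If $f$ is bounded, then $T_fu=Q(fu)$, where $Q$ is the orthogonal projection of $L^2(\mathbb{D},dA)$ onto $L^2_h$. Standing assumption: all symbols considered belong to $L^1(\mathbb{D},dA)$ and are such that the Toeplitz operator so defined extends to a bounded operator on $L^2_h$; $T_f$ denotes this extension. A radial function $\phi$ on $\mathbb{D}$ is one depending only on $r=|z|$; it is identified with a function on $[0,1)$ (an element of $L^1([0,1],r\,dr)$), and functions are identified when equal almost everywhere. For an integer $p$, $e^{ip\theta}\phi$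 denotes the symbol $re^{i\theta}\mapsto e^{ip\theta}\phi(r)$. Two bounded operators $S,T$ commute if $ST=TS$. The Mellin convolution of $f,g\in L^1([0,1],r\,dr)$ is $(f\ast_M g)(r)=\int_r^1 f(t)\,g\!\left(\frac{r}{t}\right)\frac{dt}{t}$ for (almost every) $r\in(0,1)$. *)

theory Defs
  imports "HOL-Analysis.Analysis"
begin

definition disk_measure :: "complex measure" where
  "disk_measure = density (lebesgue_on (ball 0 1)) (\<lambda>_. ennreal (1 / pi))"

definition radial_measure :: "real measure" where
  "radial_measure = density (lebesgue_on {0..1}) (\<lambda>r. ennreal r)"

text \<open>Complex-valued harmonic functions: twice continuously (real) differentiable functions
  with vanishing Laplacian; \<open>u'' z\<close> is the second derivative, and \<open>1\<close>, \<open>\<i>\<close> are the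
  directions of the two real coordinates.\<close>

definition harmonic_on :: "(complex \<Rightarrow> complex) \<Rightarrow> complex set \<Rightarrow> bool" where
  "harmonic_on u S \<longleftrightarrow>
     (\<exists>(u' :: complex \<Rightarrow> complex \<Rightarrow>\<^sub>L complex)
       (u'' :: complex \<Rightarrow> complex \<Rightarrow>\<^sub>L (complex \<Rightarrow>\<^sub>L complex)).
        (\<forall>z\<in>S. (u has_derivative blinfun_apply (u' z)) (at z)) \<and>
        (\<forall>z\<in>S. (u' has_derivative blinfun_apply (u'' z)) (at z)) \<and>
        continuous_on S u'' \<and>
        (\<forall>z\<in>S. blinfun_apply (blinfun_apply (u'' z) 1) 1
              + blinfun_apply (blinfun_apply (u'' z) \<i>) \<i> = 0))"

text \<open>A function on the disk is represented by its extension by \<open>0\<close> to the whole plane. Since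
  harmonic functions are continuous, distinct members of \<open>harmonic_bergman\<close> are distinct elements
  of the Hilbert space, so equality of functions is equality in that space.\<close>

definition on_disk :: "(complex \<Rightarrow> complex) \<Rightarrow> complex \<Rightarrow> complex" where
  "on_disk u z = (if z \<in> ball 0 1 then u z else 0)"

definition harmonic_bergman :: "(complex \<Rightarrow> complex) set" where
  "harmonic_bergman =
     {u. harmonic_on u (ball 0 1) \<and> integrable disk_measure (\<lambda>z. (cmod (u z))\<^sup>2) \<and>
         (\<forall>z. z \<notin> ball 0 1 \<longrightarrow> u z = 0)}"

definition bergman_norm :: "(complex \<Rightarrow> complex) \<Rightarrow> real" where
  "bergman_norm u = sqrt (LINT z|disk_measure. (cmod (u z))\<^sup>2)"

definition repro_kernel :: "complex \<Rightarrow> complex \<Rightarrow> complex" where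
  "repro_kernel z = (THE R. R \<in> harmonic_bergman \<and>
     (\<forall>u\<in>harmonic_bergman. u z = (LINT w|disk_measure. u w * cnj (R w))))"

definition harmonic_polynomials :: "(complex \<Rightarrow> complex) set" where
  "harmonic_polynomials =
     {on_disk (\<lambda>z. \<Sum>n\<le>N. a n * z ^ n + b n * cnj z ^ n) | (N::nat) a b. True}"

definition bounded_operator :: "((complex \<Rightarrow> complex) \<Rightarrow> complex \<Rightarrow> complex) \<Rightarrow> bool" where
  "bounded_operator S \<longleftrightarrow>
     (\<forall>u\<in>harmonic_bergman. S u \<in> harmonic_bergman) \<and>
     (\<forall>u\<in>harmonic_bergman. \<forall>v\<in>harmonic_bergman.
        S (\<lambda>z. u z + v z) = (\<lambda>z. S u z + S v z)) \<and>
     (\<forall>c. \<forall>u\<in>harmonic_bergman. S (\<lambda>z. c * u z) = (\<lambda>z. c * S u z)) \<and>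
     (\<exists>K. \<forall>u\<in>harmonic_bergman. bergman_norm (S u) \<le> K * bergman_norm u)"

definition toeplitz_pre ::
  "(complex \<Rightarrow> complex) \<Rightarrow> (complex \<Rightarrow> complex) \<Rightarrow> complex \<Rightarrow> complex" where
  "toeplitz_pre f u = on_disk (\<lambda>z. LINT w|disk_measure. f w * u w * repro_kernel z w)"

definition toeplitz_extension ::
  "(complex \<Rightarrow> complex) \<Rightarrow> ((complex \<Rightarrow> complex) \<Rightarrow> complex \<Rightarrow> complex) \<Rightarrow> bool" where
  "toeplitz_extension f S \<longleftrightarrow>
     bounded_operator S \<and> (\<forall>u\<in>harmonic_polynomials. S u = toeplitz_pre f u)"

definition toeplitz_symbol :: "(complex \<Rightarrow> complex) \<Rightarrow> bool" where
  "toeplitz_symbol f \<longleftrightarrow> integrable disk_measure f \<and> (\<exists>S. toeplitz_extension f S)"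

text \<open>Harmonic polynomials are dense, so on \<open>harmonic_bergman\<close> the value of \<open>toeplitz f\<close> does
  not depend on the choice; elsewhere it is irrelevant.\<close>

definition toeplitz ::
  "(complex \<Rightarrow> complex) \<Rightarrow> (complex \<Rightarrow> complex) \<Rightarrow> complex \<Rightarrow> complex" where
  "toeplitz f = (SOME S. toeplitz_extension f S)"

definition operators_commute ::
  "((complex \<Rightarrow> complex) \<Rightarrow> complex \<Rightarrow> complex) \<Rightarrow>
   ((complex \<Rightarrow> complex) \<Rightarrow> complex \<Rightarrow> complex) \<Rightarrow> bool" where
  "operators_commute S T \<longleftrightarrow> (\<forall>u\<in>harmonic_bergman. S (T u) = T (S u))"

text \<open>The symbol \<open>r e\<^sup>i\<^sup>\<theta> \<mapsto> e\<^sup>i\<^sup>p\<^sup>\<theta> \<phi>(r)\<close>.\<close>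

definition quasihomogeneous :: "int \<Rightarrow> (real \<Rightarrow> complex) \<Rightarrow> complex \<Rightarrow> complex" where
  "quasihomogeneous p \<phi> z = cis (of_int p * Arg z) * \<phi> (cmod z)"

definition mellin_convolution ::
  "(real \<Rightarrow> complex) \<Rightarrow> (real \<Rightarrow> complex) \<Rightarrow> real \<Rightarrow> complex" where
  "mellin_convolution f g r =
     (LINT t|lebesgue_on {r..1}. f t * g (r / t) * complex_of_real (1 / t))"

end

theory Submission
  imports Defs "HOL-Complex_Analysis.Complex_Analysis"
begin

text \<open>Let \<open>e\<^sub>n(r e\<^sup>i\<^sup>\<theta>) = r\<^bsup>|n|\<^esup> e\<^bsup>in\<theta>\<^esup>\<close> and let \<open>M\<^sub>\<phi>(x) = \<integral>\<^sub>0\<^sup>1 \<phi>(r) r\<^sup>x dr\<close>. The reproducing kernel is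
  \<open>\<Sum>\<^sub>n (|n| + 1) e\<^sub>n(z) cnj (e\<^sub>n(w))\<close>, so the Toeplitz operator with symbol \<open>e\<^sup>i\<^sup>p\<^sup>\<theta> \<phi>\<close> maps \<open>e\<^sub>n\<close> to
  \<open>2 (|n+p| + 1) M\<^sub>\<phi>(|n| + |n+p| + 1) e\<^bsub>n+p\<^esub>\<close>. With \<open>F = M\<^sub>\<phi> M\<^sub>\<psi>\<close>, the Mellin transform of
  \<open>\<Phi> = \<phi> *\<^sub>M \<psi>\<close>, commutation means
  \<open>(|n-p| + 1) F(|n| + |n-p| + 1) = (|n+p| + 1) F(|n| + |n+p| + 1)\<close> for all integers \<open>n\<close>.

  For \<open>n = p + j\<close> with \<open>j \<ge> 0\<close> this says that \<open>H\<^sub>j = (j + 1) (j + p + 1) F(p + 2j + 1)\<close> is periodic in \<open>j\<close> with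
  period \<open>p\<close>. Along each residue class the values of \<open>F\<close> are those of the Mellin transform of
  \<open>(2 H\<^sub>j / p) (r\<^bsup>-p\<^esup> - r\<^sup>p)\<close>, and these moments determine \<open>\<Phi>\<close>. Comparing the classes of \<open>0\<close> and \<open>1\<close> gives
  \<open>H\<^sub>0 = H\<^sub>1\<close>, while \<open>n = 1\<close> gives \<open>H\<^sub>1 = 2p F(p + 1)\<close>; as \<open>H\<^sub>0 = (p + 1) F(p + 1)\<close>, either \<open>p = 1\<close> or
  \<open>\<Phi> = 0\<close>. In the latter case \<open>M\<^sub>\<phi> M\<^sub>\<psi> = 0\<close>, and analyticity forces one of the symbols to vanish.\<close>

subsection \<open>Area measure on the disk\<close>


text \<open>The recurrence links j only to j + p, so a priori every residue class carries its own
  constant. The classes are tied together because a single one already determines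
  \<open>\<Phi>\<close>: its exponents advance in steps of 2p, and polynomials in r^(2p) are dense
  in the continuous functions on [0,1]. The solution has its shape because the integral of
  r^(p+2j+1) (r^(-p) - r^p) over (0,1) is 1/(2(j+1)) - 1/(2(j+p+1)) = p / (2(j+1)(j+p+1)). For p > 1
  the index n = 1 lies outside the family n = p + j, since there |n - p| = p - n. This is what makes
  its equation independent of the periodicity. Two obstacles shape the preparations. The kernel is
  given by a definite description over functions with vanishing Laplacian, so its formula rests on
  splitting these into holomorphic and antiholomorphic parts. The symbols are Lebesgue measurable
  and integrable only against r dr, so they are replaced by Borel functions, transforms are used
  only at exponents x >= 1, and \<open>\<Phi>\<close> is integrated only with a power of r in
  front.\<close>

lemma lborel_complex_eq_distr:
  "(lborel :: complex measure) =
     distr (lborel \<Otimes>\<^sub>M lborel) borel (\<lambda>(x, y). Complex x y)"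
proof (rule lborel_eqI)
  have M: "(\<lambda>(x, y). Complex x y) \<in> borel_measurable (lborel \<Otimes>\<^sub>M lborel)"
    by (simp add: Complex_eq case_prod_beta)
  fix l u :: complex assume le: "\<And>b. b \<in> Basis \<Longrightarrow> l \<bullet> b \<le> u \<bullet> b"
  have B: "(Basis :: complex set) = {1, \<i>}" by (simp add: Basis_complex_def)
  have "emeasure (distr (lborel \<Otimes>\<^sub>M lborel) borel (\<lambda>(x, y). Complex x y)) (box l u)
     = emeasure (lborel \<Otimes>\<^sub>M lborel) ({Re l<..<Re u} \<times> {Im l<..<Im u})"
    by (subst emeasure_distr[OF M]) (auto simp: space_pair_measure box_def B inner_complex_def
        intro!: arg_cong[where f = "emeasure (lborel \<Otimes>\<^sub>M lborel)"])
  also have "\<dots> = ennreal (Re u - Re l) * ennreal (Im u - Im l)"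
    using le[of 1] le[of \<i>] by (subst lborel.emeasure_pair_measure_Times) (auto simp: B)
  also have "\<dots> = (\<Prod>b\<in>Basis. (u - l) \<bullet> b)"
    using le[of 1] le[of \<i>] by (simp add: B ennreal_mult')
  finally show "emeasure (distr (lborel \<Otimes>\<^sub>M lborel) borel (\<lambda>(x, y). Complex x y)) (box l u) = (\<Prod>b\<in>Basis. (u - l) \<bullet> b)" .
qed simp

text \<open>Both orders of integration are recorded: a horizontal shear is a translation in x for
  fixed y, a vertical one a translation in y for fixed x.\<close>

lemma nn_integral_lborel_complex:
  fixes f :: "complex \<Rightarrow> ennreal"
  assumes [measurable]: "f \<in> borel_measurable borel"
  shows "(\<integral>\<^sup>+z. f z \<partial>lborel) = (\<integral>\<^sup>+x. \<integral>\<^sup>+y. f (Complex x y) \<partial>lborel \<partial>lborel)"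
    and "(\<integral>\<^sup>+z. f z \<partial>lborel) = (\<integral>\<^sup>+y. \<integral>\<^sup>+x. f (Complex x y) \<partial>lborel \<partial>lborel)"
proof -
  have M[measurable]: "(\<lambda>(x, y). Complex x y) \<in> borel_measurable (lborel \<Otimes>\<^sub>M lborel)"
    by (simp add: Complex_eq case_prod_beta)
  have M2: "(\<lambda>(x, y). f (Complex x y)) \<in> borel_measurable (lborel \<Otimes>\<^sub>M lborel)"
    using measurable_compose[OF M assms] by (simp add: case_prod_beta)
  have "(\<integral>\<^sup>+z. f z \<partial>lborel) = (\<integral>\<^sup>+(x,y). f (Complex x y) \<partial>(lborel \<Otimes>\<^sub>M lborel))"
    by (subst lborel_complex_eq_distr, subst nn_integral_distr[OF M]) (auto simp: case_prod_beta[abs_def])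
  with lborel.nn_integral_fst[OF M2] lborel_pair.nn_integral_snd[OF M2]
  show "(\<integral>\<^sup>+z. f z \<partial>lborel) = (\<integral>\<^sup>+x. \<integral>\<^sup>+y. f (Complex x y) \<partial>lborel \<partial>lborel)"
    "(\<integral>\<^sup>+z. f z \<partial>lborel) = (\<integral>\<^sup>+y. \<integral>\<^sup>+x. f (Complex x y) \<partial>lborel \<partial>lborel)"
    by simp_all
qed

lemma nn_integral_shear:
  fixes f :: "complex \<Rightarrow> ennreal"
  assumes [measurable]: "f \<in> borel_measurable borel"
  shows "(\<integral>\<^sup>+z. f (Complex (Re z + a * Im z) (Im z)) \<partial>lborel) = (\<integral>\<^sup>+z. f z \<partial>lborel)"
    and "(\<integral>\<^sup>+z. f (Complex (Re z) (Im z + a * Re z)) \<partial>lborel) = (\<integral>\<^sup>+z. f z \<partial>lborel)"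
proof -
  have [measurable]: "(\<lambda>x. Complex (g x) (h x)) \<in> borel_measurable M" 
    if [measurable]: "g \<in> borel_measurable M" "h \<in> borel_measurable M" for g h and M :: "'z measure"
    by (simp add: Complex_eq)
  show "(\<integral>\<^sup>+z. f (Complex (Re z + a * Im z) (Im z)) \<partial>lborel) = (\<integral>\<^sup>+z. f z \<partial>lborel)"
  proof (subst (1 2) nn_integral_lborel_complex(2))
    have "(\<integral>\<^sup>+x. f (Complex (x + a * y) y) \<partial>lborel) = (\<integral>\<^sup>+x. f (Complex x y) \<partial>lborel)" for y
      using nn_integral_real_affine[of "\<lambda>x. f (Complex x y)" 1 "a * y"] by (simp add: add.commute)
    then show "(\<integral>\<^sup>+y. \<integral>\<^sup>+x. f (Complex (Re (Complex x y) + a * Im (Complex x y)) (Im (Complex x y))) \<partial>lborel \<partial>lborel) = (\<integral>\<^sup>+y. \<integral>\<^sup>+x. f (Complex x y) \<partial>lborel \<partial>lborel)"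
      by simp
  qed simp_all
  show "(\<integral>\<^sup>+z. f (Complex (Re z) (Im z + a * Re z)) \<partial>lborel) = (\<integral>\<^sup>+z. f z \<partial>lborel)"
  proof (subst (1 2) nn_integral_lborel_complex(1))
    have "(\<integral>\<^sup>+y. f (Complex x (y + a * x)) \<partial>lborel) = (\<integral>\<^sup>+y. f (Complex x y) \<partial>lborel)" for x
      using nn_integral_real_affine[of "\<lambda>y. f (Complex x y)" 1 "a * x"] by (simp add: add.commute)
    then show "(\<integral>\<^sup>+x. \<integral>\<^sup>+y. f (Complex (Re (Complex x y)) (Im (Complex x y) + a * Re (Complex x y))) \<partial>lborel \<partial>lborel) = (\<integral>\<^sup>+x. \<integral>\<^sup>+y. f (Complex x y) \<partial>lborel \<partial>lborel)"
      by simp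
  qed simp_all
qed

text \<open>A rotation is a product of three shears, and shears preserve area by Fubini.\<close>

lemma lborel_distr_rotation:
  fixes c :: complex
  assumes c: "cmod c = 1" "Im c \<noteq> 0"
  shows "distr lborel borel ((*) c) = lborel"
proof (rule measure_eqI)
  fix A assume "A \<in> sets (distr lborel borel ((*) c))"
  then have [measurable]: "A \<in> sets borel" by simp
  \<comment> \<open>For \<open>c = cis t\<close> this is -tan(t/2): the rotation factors into a
    horizontal shear by \<open>s\<close>, a vertical one by sin t and again the one by
    \<open>s\<close>. The division is the reason why \<open>c\<close> must not be real.\<close>
  define s where "s = (Re c - 1) / Im c"
  have s: "s * Im c = Re c - 1" using c by (simp add: s_def)
  have n: "(Re c)\<^sup>2 + (Im c)\<^sup>2 = 1" using c(1) by (metis cmod_power2 one_power2)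
  have "(s * (Re c + 1) + Im c) * Im c = (Re c - 1) * (Re c + 1) + Im c * Im c" using s by algebra
  also have "\<dots> = 0" using n by (simp add: power2_eq_square algebra_simps)
  finally have s2: "s * Re c + s = - Im c" using c by (simp add: distrib_left add_eq_0_iff2)
  define g where "g = (\<lambda>z. indicator A z :: ennreal)"
  define S where "S = (\<lambda>z. Complex (Re z + s * Im z) (Im z))"
  define V where "V = (\<lambda>z. Complex (Re z) (Im z + Im c * Re z))"
  have S_apply: "S z = Complex (Re z + s * Im z) (Im z)" for z by (simp add: S_def)
  have [measurable]: "S \<in> borel_measurable borel" "V \<in> borel_measurable borel" "g \<in> borel_measurable borel"
    unfolding S_def V_def g_def by (simp_all add: Complex_eq)
  have eq: "S (V (S z)) = c * z" for z
  proof (rule complex_eqI)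
    have "Re (S (V (S z))) = Re z + s * Im z + s * (Im z + Im c * (Re z + s * Im z))" 
      by (simp add: S_def V_def)
    also have "\<dots> = Re c * Re z - Im c * Im z"
      using s s2 by algebra
    finally show "Re (S (V (S z))) = Re (c * z)" by simp
    have "Im (S (V (S z))) = Im z + Im c * (Re z + s * Im z)" 
      by (simp add: S_def V_def)
    also have "\<dots> = Re c * Im z + Im c * Re z" using s by algebra
    finally show "Im (S (V (S z))) = Im (c * z)" by simp
  qed
  have "emeasure (distr lborel borel ((*) c)) A = (\<integral>\<^sup>+z. g z \<partial>(distr lborel borel ((*) c)))"
    by (simp add: g_def)
  also have "\<dots> = (\<integral>\<^sup>+z. g (S (V (S z))) \<partial>lborel)"
    unfolding eq by (rule nn_integral_distr) auto
  also have "\<dots> = (\<integral>\<^sup>+z. g (S (V z)) \<partial>lborel)"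
    using nn_integral_shear(1)[of "\<lambda>z. g (S (V z))" s] by (simp add: S_apply[symmetric])
  also have "\<dots> = (\<integral>\<^sup>+z. g (S z) \<partial>lborel)"
    using nn_integral_shear(2)[of "\<lambda>z. g (S z)" "Im c"] by (simp add: V_def)
  also have "\<dots> = (\<integral>\<^sup>+z. g z \<partial>lborel)"
    using nn_integral_shear(1)[of g s] by (simp add: S_apply[symmetric])
  finally show "emeasure (distr lborel borel ((*) c)) A = emeasure lborel A"
    by (simp add: g_def)
qed simp

text \<open>\<open>disk_measure\<close> lives on the Lebesgue sets, whereas shears, pushforwards and
  Fubini are carried out on Borel sets. For a Borel integrand the completion changes
  nothing.\<close>

lemma disk_measure_borel:
  fixes f :: "complex \<Rightarrow> 'b::{banach, second_countable_topology}"
  assumes [measurable]: "f \<in> borel_measurable borel"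
  shows "integrable disk_measure f \<longleftrightarrow> integrable lborel (\<lambda>w. indicator (ball 0 1) w *\<^sub>R f w)"
    and "(LINT w|disk_measure. f w) = (1/pi) *\<^sub>R (LINT w|lborel. indicator (ball 0 1) w *\<^sub>R f w)"
proof -
  have [measurable]: "f \<in> borel_measurable (lebesgue_on (ball 0 1))"
    by (intro measurable_restrict_space1 measurable_completion) simp
  have b: "(\<lambda>w. indicator (ball 0 1) w *\<^sub>R f w) \<in> borel_measurable lborel" by (auto intro!: borel_measurable_scaleR borel_measurable_indicator)
  have "integrable disk_measure f \<longleftrightarrow> integrable (lebesgue_on (ball 0 1)) (\<lambda>w. (1/pi) *\<^sub>R f w)"
    unfolding disk_measure_def by (subst integrable_density) auto
  also have "\<dots> \<longleftrightarrow> integrable (lebesgue_on (ball 0 1)) f"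
    using integrable_scaleR_right[of pi "lebesgue_on (ball 0 1)" "\<lambda>w. (1/pi) *\<^sub>R f w"] by auto
  also have "\<dots> \<longleftrightarrow> integrable lborel (\<lambda>w. indicator (ball 0 1) w *\<^sub>R f w)"
    by (subst integrable_restrict_space) (auto simp: integrable_completion[OF b])
  finally show "integrable disk_measure f \<longleftrightarrow> integrable lborel (\<lambda>w. indicator (ball 0 1) w *\<^sub>R f w)" .
  have "(LINT w|disk_measure. f w) = (LINT w|lebesgue_on (ball 0 1). (1/pi) *\<^sub>R f w)"
    unfolding disk_measure_def by (subst integral_density) auto
  also have "\<dots> = (1/pi) *\<^sub>R (LINT w|lebesgue_on (ball 0 1). f w)" by simp
  also have "(LINT w|lebesgue_on (ball 0 1). f w) = (LINT w|lborel. indicator (ball 0 1) w *\<^sub>R f w)"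
    by (subst integral_restrict_space) (auto simp: integral_completion[OF b])
  finally show "(LINT w|disk_measure. f w) = (1/pi) *\<^sub>R (LINT w|lborel. indicator (ball 0 1) w *\<^sub>R f w)" .
qed

lemma disk_integral_rotate:
  fixes f :: "complex \<Rightarrow> complex"
  assumes [measurable]: "f \<in> borel_measurable borel" and c: "cmod c = 1" "Im c \<noteq> 0"
  shows "(LINT w|disk_measure. f (c * w)) = (LINT w|disk_measure. f w)"
proof -
  have "(LINT w|lborel. indicator (ball 0 1) w *\<^sub>R f w) =
      (LINT w|distr lborel borel ((*) c). indicator (ball 0 1) w *\<^sub>R f w)"
    by (simp add: lborel_distr_rotation[OF c])
  also have "\<dots> = (LINT w|lborel. indicator (ball 0 1) (c * w) *\<^sub>R f (c * w))"
    by (rule integral_distr) (auto intro!: borel_measurable_scaleR borel_measurable_indicator)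
  also have "\<dots> = (LINT w|lborel. indicator (ball 0 1) w *\<^sub>R f (c * w))"
    using c by (intro Bochner_Integration.integral_cong) (auto simp: indicator_def norm_mult)
  finally show ?thesis by (subst (1 2) disk_measure_borel(2)) simp_all
qed

text \<open>Rotating by \<open>t = 1/m\<close> multiplies the integral by \<open>e\<^sup>i \<noteq> 1\<close>.\<close>

lemma integral_disk_homogeneous_eq_0:
  fixes g :: "complex \<Rightarrow> complex" and m :: int
  assumes "g \<in> borel_measurable borel" and "m \<noteq> 0"
    and hom: "\<And>t w. g (cis t * w) = cis (of_int m * t) * g w"
  shows "(LINT w|disk_measure. g w) = 0"
proof -
  define t where "t = 1 / real_of_int m"
  \<comment> \<open>Here 0 < |t| <= 1 < pi, so \<open>cis t\<close> is not real and the rotation is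
    one of those covered by the shear factorization.\<close>
  have t: "sin t \<noteq> 0"
  proof
    assume "sin t = 0"
    then obtain k where k: "t = of_int k * pi" by (auto simp: sin_zero_iff_int2)
    have "\<bar>t\<bar> \<le> 1" using assms(2) by (auto simp: t_def abs_le_iff)
    have "k \<noteq> 0" using k assms(2) by (auto simp: t_def)
    then have "\<bar>real_of_int k\<bar> \<ge> 1" by linarith
    then have "\<bar>t\<bar> \<ge> pi" unfolding k abs_mult using pi_gt_zero by (simp add: mult_le_cancel_right1)
    with \<open>\<bar>t\<bar> \<le> 1\<close> pi_gt3 show False by linarith
  qed
  have "cis (of_int m * t) = cis 1" using assms(2) by (simp add: t_def)
  moreover have "cis 1 \<noteq> 1" 
  proof
    assume "cis 1 = 1"
    then have "sin (1::real) = 0" by (metis cis.sel(2) one_complex.sel(2))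
    moreover have "sin (1::real) > 0" using pi_gt3 by (intro sin_gt_zero) auto
    ultimately show False by simp
  qed
  ultimately have c: "cis (of_int m * t) \<noteq> 1" by simp
  have "(LINT w|disk_measure. g w) = (LINT w|disk_measure. g (cis t * w))"
    by (rule disk_integral_rotate[symmetric]) (use assms t in auto)
  also have "\<dots> = cis (of_int m * t) * (LINT w|disk_measure. g w)"
    by (simp add: hom)
  finally show ?thesis using c by simp
qed

text \<open>The distribution of \<open>|w|\<close> under the normalized area measure, which replaces polar coordinates.\<close>

definition radial_density :: "real measure" where
  "radial_density = density lborel (\<lambda>r. ennreal (2 * r * indicator {0<..<1} r))"

lemma emeasure_radial_density_Ioi:
  "emeasure radial_density {a<..} = ennreal (1 - (min 1 (max 0 a))\<^sup>2)"
proof -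
  define b where "b = min 1 (max 0 a)"
  have b: "0 \<le> b" "b \<le> 1" by (auto simp: b_def)
  have "emeasure radial_density {a<..} = (\<integral>\<^sup>+r. ennreal (2 * r * indicator {0<..<1} r) * indicator {a<..} r \<partial>lborel)"
    unfolding radial_density_def by (rule emeasure_density) auto
  also have "\<dots> = (\<integral>\<^sup>+r. ennreal (2 * r) * indicator {b..1} r \<partial>lborel)"
  proof (intro nn_integral_cong_AE)
    have "AE r in lborel. r \<noteq> b \<and> r \<noteq> (1::real)"
      by (intro AE_conjI AE_lborel_singleton)
    then show "AE r in lborel. ennreal (2 * r * indicator {0<..<1} r) * indicator {a<..} r = ennreal (2 * r) * indicator {b..1} r"
      by eventually_elim (auto simp: b_def indicator_def min_def max_def split: if_splits)
  qed
  also have "\<dots> = ennreal (1\<^sup>2 - b\<^sup>2)"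
    using b by (intro nn_integral_FTC_Icc) (auto intro!: derivative_eq_intros)
  finally show ?thesis by (simp add: b_def)
qed

text \<open>Measures on the line that are finite on the half-lines \<open>{a<..}\<close> are
  determined by their values there. With \<open>b\<close> the value of \<open>a\<close> clipped to
  [0,1], the part of the disk with modulus above \<open>a\<close> has area pi (1 - b^2).\<close>

lemma distr_disk_cmod:
  "distr (density lborel (\<lambda>w::complex. ennreal (indicator (ball 0 1) w / pi))) borel cmod = radial_density"
  (is "?D = _")
proof (rule measure_eqI_lessThan)
  have B: "emeasure lborel (cball 0 1 :: complex set) = ennreal pi"
    using emeasure_cball[of 1 "0::complex"] by (simp add: unit_ball_vol_2)
  have main: "emeasure ?D {a<..} = ennreal (1 - (min 1 (max 0 a))\<^sup>2)" for a
  proof -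
    define b where "b = min 1 (max 0 a)"
    have b: "0 \<le> b" "b \<le> 1" by (auto simp: b_def)
    have "emeasure ?D {a<..} = (\<integral>\<^sup>+w. ennreal (indicator (ball 0 1) w / pi) * indicator (cmod -` {a<..}) w \<partial>lborel)"
    proof (subst emeasure_distr)
      have "cmod -` {a<..} \<in> sets borel" 
        using measurable_sets_borel[of cmod borel "{a<..}"] by simp
      moreover have "(\<lambda>w::complex. ennreal (indicator (ball 0 1) w / pi)) \<in> borel_measurable lborel"
        by (auto intro!: borel_measurable_indicator borel_measurable_divide measurable_compose[OF _ measurable_ennreal])
      ultimately show "emeasure (density lborel (\<lambda>w. ennreal (indicator (ball 0 1) w / pi))) (cmod -` {a<..} \<inter> space (density lborel (\<lambda>w. ennreal (indicator (ball 0 1) w / pi)))) 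
         = (\<integral>\<^sup>+w. ennreal (indicator (ball 0 1) w / pi) * indicator (cmod -` {a<..}) w \<partial>lborel)"
        by (simp add: emeasure_density)
    qed auto
    also have "\<dots> = (\<integral>\<^sup>+w. ennreal (1 / pi) * indicator (ball 0 1 \<inter> cmod -` {a<..}) w \<partial>lborel)"
      by (intro nn_integral_cong) (auto simp: indicator_def)
    also have "\<dots> = ennreal (1 / pi) * emeasure lborel (ball 0 1 \<inter> cmod -` {a<..})"
      using measurable_sets_borel[of cmod borel "{a<..}"]
      by (subst nn_integral_cmult_indicator) (auto intro!: sets.Int)
    also have "emeasure lborel (ball 0 1 \<inter> cmod -` {a<..}) = ennreal (pi * (1 - b\<^sup>2))"
    proof (cases "a < 0")
      case True
      then have "ball 0 1 \<inter> cmod -` {a<..} = ball 0 1" by (auto intro: less_le_trans[OF _ norm_ge_zero])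
      then show ?thesis using True emeasure_ball[of 1 "0::complex"] by (simp add: unit_ball_vol_2 b_def)
    next
      case False
      have eq: "ball 0 1 \<inter> cmod -` {a<..} = ball 0 1 - cball 0 b" using False by (auto simp: b_def)
      have "emeasure lborel (ball 0 1 - cball 0 b :: complex set) = ennreal (pi * (1 - b\<^sup>2))"
      \<comment> \<open>The closed disk of radius 1 is not contained in the open one, so subtraction
        of areas applies only for \<open>b < 1\<close>.\<close>
      proof (cases "b = 1")
        case True 
        have e: "ball 0 1 - cball 0 1 = ({}::complex set)" by auto
        show ?thesis unfolding True e by simp
      next
        case False
        have "emeasure lborel (ball 0 1 - cball 0 b :: complex set) = emeasure lborel (ball 0 1 :: complex set) - emeasure lborel (cball 0 b :: complex set)"
          using b False emeasure_cball[of b "0::complex"] by (intro emeasure_Diff) auto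
        also have "\<dots> = ennreal pi - ennreal (pi * b\<^sup>2)"
          using b emeasure_cball[of b "0::complex"] emeasure_ball[of 1 "0::complex"] by (simp add: unit_ball_vol_2)
        also have "\<dots> = ennreal (pi * (1 - b\<^sup>2))"
          using b by (subst ennreal_minus) (auto simp: algebra_simps)
        finally show ?thesis .
      qed
      then show ?thesis using eq by simp
    qed
    also have "ennreal (1 / pi) * \<dots> = ennreal (1 - b\<^sup>2)"
      using b by (subst ennreal_mult[symmetric]) (auto simp: power_le_one)
    finally show ?thesis by (simp add: b_def)
  qed
  show "emeasure ?D {a<..} < \<infinity>" for a by (simp add: main)
  show "emeasure ?D {a<..} = emeasure radial_density {a<..}" for a
    by (simp add: main emeasure_radial_density_Ioi)
qed (auto simp: radial_density_def)

lemma disk_measure_density: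
  fixes f :: "complex \<Rightarrow> 'b::{banach, second_countable_topology}"
  assumes [measurable]: "f \<in> borel_measurable borel"
  shows "integrable disk_measure f \<longleftrightarrow> integrable (density lborel (\<lambda>w. ennreal (indicator (ball 0 1) w / pi))) f"
    and "(LINT w|disk_measure. f w) = (LINT w|density lborel (\<lambda>w. ennreal (indicator (ball 0 1) w / pi)). f w)"
proof -
  have *: "(indicator (ball 0 1) w / pi) *\<^sub>R f w = (1/pi) *\<^sub>R (indicator (ball 0 1) w *\<^sub>R f w)" for w
    by simp
  have m: "(\<lambda>w. indicator (ball 0 1) w / pi) \<in> borel_measurable borel" "f \<in> borel_measurable lborel"
    by (auto intro!: borel_measurable_indicator borel_measurable_divide)
  let ?D = "density lborel (\<lambda>w. ennreal (indicator (ball 0 1) w / pi))"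
  let ?g = "\<lambda>w. indicator (ball 0 1) w *\<^sub>R f w"
  have "integrable ?D f \<longleftrightarrow> integrable lborel (\<lambda>w. (indicator (ball 0 1) w / pi) *\<^sub>R f w)"
    using m by (intro integrable_density) auto
  also have "\<dots> \<longleftrightarrow> integrable lborel (\<lambda>w. (1/pi) *\<^sub>R ?g w)"
    by (simp only: *)
  also have "\<dots> \<longleftrightarrow> integrable lborel ?g"
    using integrable_scaleR_right[of pi "lborel" "\<lambda>w. (1/pi) *\<^sub>R ?g w"] 
      integrable_scaleR_right[of "1/pi" "lborel" ?g] by auto
  finally show "integrable disk_measure f \<longleftrightarrow> integrable ?D f"
    by (simp add: disk_measure_borel)
  have "(LINT w|?D. f w) = (LINT w|lborel. (indicator (ball 0 1) w / pi) *\<^sub>R f w)"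
    using m by (intro integral_density) auto
  also have "\<dots> = (LINT w|lborel. (1/pi) *\<^sub>R ?g w)"
    by (simp only: *)
  also have "\<dots> = (1/pi) *\<^sub>R (LINT w|lborel. ?g w)" by (rule integral_scaleR_right)
  finally show "(LINT w|disk_measure. f w) = (LINT w|?D. f w)"
    by (simp add: disk_measure_borel)
qed

lemma disk_integral_radial:
  fixes f :: "real \<Rightarrow> complex"
  assumes [measurable]: "f \<in> borel_measurable borel"
  shows "integrable disk_measure (\<lambda>w. f (cmod w)) \<longleftrightarrow> integrable radial_density f"
    and "(LINT w|disk_measure. f (cmod w)) = (LINT r|radial_density. f r)"
  unfolding distr_disk_cmod[symmetric]
  by (subst disk_measure_density, simp, subst integrable_distr_eq integral_distr, simp, simp, simp)+


lemma integrable_radial_density: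
  fixes f :: "real \<Rightarrow> complex"
  assumes [measurable]: "f \<in> borel_measurable borel" and 0: "\<And>r. r \<notin> {0<..<1} \<Longrightarrow> f r = 0"
  shows "integrable radial_density f \<longleftrightarrow> integrable lborel (\<lambda>r. r *\<^sub>R f r)"
    and "(LINT r|radial_density. f r) = 2 * (LINT r|lborel. r *\<^sub>R f r)"
proof -
  have eq: "(2 * r * indicator {0<..<1} r) *\<^sub>R f r = 2 * (r *\<^sub>R f r)" for r
    using 0[of r] by (auto simp: indicator_def scaleR_conv_of_real)
  have "integrable radial_density f \<longleftrightarrow> integrable lborel (\<lambda>r. (2 * r * indicator {0<..<1} r) *\<^sub>R f r)"
    unfolding radial_density_def by (subst integrable_density) (auto simp: indicator_def)
  then show "integrable radial_density f \<longleftrightarrow> integrable lborel (\<lambda>r. r *\<^sub>R f r)"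
    unfolding eq
    using integrable_mult_right[of "1/2" lborel "\<lambda>r. 2 * (r *\<^sub>R f r)"]
      integrable_mult_right[of 2 lborel "\<lambda>r. r *\<^sub>R f r"] by auto
  have "(LINT r|radial_density. f r) = (LINT r|lborel. (2 * r * indicator {0<..<1} r) *\<^sub>R f r)"
    unfolding radial_density_def by (subst integral_density) (auto simp: indicator_def)
  then show "(LINT r|radial_density. f r) = 2 * (LINT r|lborel. r *\<^sub>R f r)"
    by (simp only: eq integral_mult_right_zero)
qed

section \<open>Null sets of radii and Borel representatives\<close>

lemma AE_disk_radial:
  assumes "AE r in lborel. r \<in> {0<..<1} \<longrightarrow> P r"
  shows "AE w in disk_measure. P (cmod w)"
proof -
  let ?D = "density lborel (\<lambda>w::complex. ennreal (indicator (ball 0 1) w / pi))"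
  have m: "(\<lambda>w::complex. ennreal (indicator (ball 0 1) w / pi)) \<in> borel_measurable lborel"
    by (auto intro!: borel_measurable_indicator borel_measurable_divide measurable_compose[OF _ measurable_ennreal])
  have "AE r in radial_density. P r"
    unfolding radial_density_def using assms by (subst AE_density) (auto simp: indicator_def elim!: eventually_mono)
  then have "AE w in ?D. P (cmod w)"
    unfolding distr_disk_cmod[symmetric] by (rule AE_distrD[rotated]) simp
  then have "AE w in lborel. w \<in> ball 0 1 \<longrightarrow> P (cmod w)"
    using m by (subst (asm) AE_density) (auto simp: indicator_def elim!: eventually_mono)
  then have "AE w in lebesgue_on (ball 0 1). P (cmod w)"
    by (subst AE_restrict_space_iff) (auto simp: AE_completion_iff elim!: eventually_mono)
  then show ?thesis
    unfolding disk_measure_def by (subst AE_density) auto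
qed

lemma AE_radial_measureI:
  assumes "AE r in lborel. r \<in> {0<..<1} \<longrightarrow> P r"
  shows "AE r in radial_measure. P r"
proof -
  have "AE r in lborel. r \<noteq> 0 \<and> r \<noteq> (1::real)"
    by (intro AE_conjI AE_lborel_singleton)
  with assms have "AE r in lborel. r \<in> {0..1} \<longrightarrow> P r"
    by eventually_elim auto
  then have "AE r in lebesgue_on {0..1}. P r"
    by (subst AE_restrict_space_iff) (auto simp: AE_completion_iff elim!: eventually_mono)
  then show ?thesis
    unfolding radial_measure_def
    by (subst AE_density) (auto elim!: eventually_mono intro!: measurable_restrict_space1 measurable_completion)
qed

text \<open>Every later computation with a symbol uses a Borel function \<open>f\<close> equal to it
  almost everywhere. Forcing \<open>f\<close> to vanish outside (0,1) lets all integrals run over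
  the whole line and makes the values of powers at 0 and at negative arguments irrelevant.\<close>

lemma radial_borel_representative:
  fixes \<phi> :: "real \<Rightarrow> complex"
  assumes "integrable radial_measure \<phi>"
  shows "\<exists>f. f \<in> borel_measurable borel \<and> (\<forall>r. r \<notin> {0<..<1} \<longrightarrow> f r = 0) \<and>
    (AE r in lborel. r \<in> {0<..<1} \<longrightarrow> \<phi> r = f r) \<and> integrable lborel (\<lambda>r. r *\<^sub>R f r)"
proof -
  have m: "\<phi> \<in> borel_measurable (lebesgue_on {0..1})"
    using borel_measurable_integrable[OF assms] by (simp add: radial_measure_def)
  define h where "h r = indicator {0..1} r *\<^sub>R \<phi> r" for r
  have h: "h \<in> borel_measurable lebesgue"
    using m by (subst (asm) borel_measurable_restrict_space_iff) (auto simp: h_def[abs_def])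
  then have "(\<lambda>r. Re (h r)) \<in> borel_measurable lebesgue" "(\<lambda>r. Im (h r)) \<in> borel_measurable lebesgue"
    by auto
  then obtain f1 f2 where [measurable]: "f1 \<in> borel_measurable lborel" "f2 \<in> borel_measurable lborel"
    and f12: "AE r in lborel. Re (h r) = f1 r" "AE r in lborel. Im (h r) = f2 r"
    using completion_ex_borel_measurable_real[of "\<lambda>r. Re (h r)" lborel]
      completion_ex_borel_measurable_real[of "\<lambda>r. Im (h r)" lborel] by blast
  define f where "f r = indicator {0<..<1} r *\<^sub>R Complex (f1 r) (f2 r)" for r
  have fm[measurable]: "f \<in> borel_measurable borel"
    unfolding f_def[abs_def] Complex_eq by simp
  have "AE r in lborel. r \<noteq> 0 \<and> r \<noteq> (1::real)"
    by (intro AE_conjI AE_lborel_singleton)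
  with f12 have hf: "AE r in lborel. h r = f r"
    by eventually_elim (auto simp: f_def h_def complex_eq_iff split: split_indicator_asm split_indicator)
  have "integrable (lebesgue_on {0..1}) (\<lambda>r. r *\<^sub>R \<phi> r)"
    using assms m unfolding radial_measure_def
    by (subst (asm) integrable_density) (auto intro!: AE_I2 measurable_restrict_space1 measurable_completion)
  then have "integrable lebesgue (\<lambda>r. indicator {0..1} r *\<^sub>R (r *\<^sub>R \<phi> r))"
    by (subst (asm) integrable_restrict_space) auto
  moreover have "AE r in lebesgue. indicator {0..1} r *\<^sub>R (r *\<^sub>R \<phi> r) = r *\<^sub>R f r"
    using hf unfolding AE_completion_iff by eventually_elim (auto simp: h_def indicator_def)
  moreover have rf: "(\<lambda>r. r *\<^sub>R f r) \<in> borel_measurable lborel" by simp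
  ultimately have "integrable lebesgue (\<lambda>r. r *\<^sub>R f r)"
    using measurable_completion[OF rf] by (elim integrable_cong_AE_imp) auto
  then have "integrable lborel (\<lambda>r. r *\<^sub>R f r)"
    using integrable_completion[OF rf] by simp
  moreover have "AE r in lborel. r \<in> {0<..<1} \<longrightarrow> \<phi> r = f r"
    using hf by eventually_elim (auto simp: h_def)
  ultimately show ?thesis
    using fm by (intro exI[of _ f]) (auto simp: f_def)
qed


subsection \<open>Harmonic functions\<close>

text \<open>The second difference of \<open>u\<close> is symmetric in \<open>v\<close> and \<open>w\<close>, so this bound yields the symmetry of the
  second derivative.\<close>

lemma second_difference_bound:
  fixes u :: "complex \<Rightarrow> complex" and u' :: "complex \<Rightarrow> complex \<Rightarrow>\<^sub>L complex"
    and L :: "complex \<Rightarrow>\<^sub>L (complex \<Rightarrow>\<^sub>L complex)"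
  assumes du: "\<And>h. norm h < d \<Longrightarrow> (u has_derivative blinfun_apply (u' (z + h))) (at (z + h))"
    and L: "\<And>h. norm h < d \<Longrightarrow> norm (u' (z + h) - u' z - L h) \<le> e * norm h"
    and t: "0 < t" "t * (norm v + norm w) < d" and e: "e \<ge> 0"
  shows "norm ((u (z + t *\<^sub>R v + t *\<^sub>R w) - u (z + t *\<^sub>R v) - u (z + t *\<^sub>R w) + u z) - t\<^sup>2 *\<^sub>R L w v)
          \<le> 2 * e * t\<^sup>2 * (norm v + norm w) * norm v"
proof -
  \<comment> \<open>\<open>g\<close> is the increment of \<open>u\<close> in the direction
    \<open>t w\<close> along the segment from z to z + t v, less its expected linear growth. Its
    change over [0,1] is the quantity to be bounded, and the mean value inequality does it.\<close>
  define g where "g s = u (z + ((s * t) *\<^sub>R v + t *\<^sub>R w)) - u (z + (s * t) *\<^sub>R v) - (s * t\<^sup>2) *\<^sub>R L w v" for s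
  define g' where "g' s = t *\<^sub>R u' (z + ((s * t) *\<^sub>R v + t *\<^sub>R w)) v - t *\<^sub>R u' (z + (s * t) *\<^sub>R v) v - t\<^sup>2 *\<^sub>R L w v" for s
  let ?N = "norm v + norm w"
  have small: "norm ((s * t) *\<^sub>R v + t *\<^sub>R w) \<le> t * ?N" "norm ((s * t) *\<^sub>R v) \<le> t * ?N" if s: "s \<in> {0..1}" for s
  proof -
    have a: "norm ((s * t) *\<^sub>R v) \<le> t * norm v" using s t by (auto simp: mult_left_le_one_le mult_right_mono)
    show "norm ((s * t) *\<^sub>R v + t *\<^sub>R w) \<le> t * ?N"
      using a t by (intro norm_triangle_le) (auto simp: algebra_simps)
    show "norm ((s * t) *\<^sub>R v) \<le> t * ?N"
      by (rule order_trans[OF a]) (use t in auto)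
  qed
  have der: "(g has_derivative (\<lambda>x. x *\<^sub>R g' s)) (at s within {0..1})" if s: "s \<in> {0..1}" for s
  proof -
    have 1: "((\<lambda>s. u (z + ((s * t) *\<^sub>R v + t *\<^sub>R w))) has_derivative (\<lambda>x. u' (z + ((s * t) *\<^sub>R v + t *\<^sub>R w)) ((x * t) *\<^sub>R v))) (at s within {0..1})"
      by (rule has_derivative_compose[where f = "\<lambda>s. z + ((s * t) *\<^sub>R v + t *\<^sub>R w)" and g = u])
        (use small[OF s] t in \<open>auto intro!: derivative_eq_intros du\<close>)
    have 2: "((\<lambda>s. u (z + (s * t) *\<^sub>R v)) has_derivative (\<lambda>x. u' (z + (s * t) *\<^sub>R v) ((x * t) *\<^sub>R v))) (at s within {0..1})"
      by (rule has_derivative_compose[where f = "\<lambda>s. z + (s * t) *\<^sub>R v" and g = u])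
        (use small[OF s] t in \<open>auto intro!: derivative_eq_intros du\<close>)
    show ?thesis
      unfolding g_def[abs_def] g'_def
      by (rule has_derivative_eq_rhs, rule has_derivative_diff, rule has_derivative_diff[OF 1 2])
        (auto intro!: derivative_eq_intros simp: fun_eq_iff blinfun.scaleR_right algebra_simps)
  qed
  have bound: "norm (g' s) \<le> 2 * e * t\<^sup>2 * ?N * norm v" if s: "s \<in> {0..1}" for s
  proof -
    let ?h1 = "(s * t) *\<^sub>R v + t *\<^sub>R w" and ?h2 = "(s * t) *\<^sub>R v"
    have eq: "g' s = t *\<^sub>R ((u' (z + ?h1) - u' z - L ?h1) v - (u' (z + ?h2) - u' z - L ?h2) v)"
      unfolding g'_def
      by (simp add: blinfun.diff_left blinfun.add_right blinfun.add_left blinfun.scaleR_right blinfun.scaleR_left algebra_simps power2_eq_square)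
    have b: "norm ((u' (z + h) - u' z - L h) v) \<le> e * (t * ?N) * norm v" if h: "norm h \<le> t * ?N" for h
    proof -
      have "norm ((u' (z + h) - u' z - L h) v) \<le> norm (u' (z + h) - u' z - L h) * norm v"
        by (rule norm_blinfun)
      also have "\<dots> \<le> e * norm h * norm v"
        using h t by (intro mult_right_mono L) auto
      also have "\<dots> \<le> e * (t * ?N) * norm v"
        using h e by (intro mult_right_mono mult_left_mono) auto
      finally show ?thesis .
    qed
    have "norm (g' s) \<le> t * (e * (t * ?N) * norm v + e * (t * ?N) * norm v)"
    proof -
      have "norm ((u' (z + ?h1) - u' z - L ?h1) v - (u' (z + ?h2) - u' z - L ?h2) v) \<le> e * (t * ?N) * norm v + e * (t * ?N) * norm v"
        by (rule norm_triangle_le_diff[OF add_mono[OF b[OF small(1)[OF s]] b[OF small(2)[OF s]]]])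
      then show ?thesis unfolding eq norm_scaleR using t by (simp only: abs_of_pos mult_left_mono less_imp_le)
    qed
    then show ?thesis by (simp add: power2_eq_square algebra_simps)
  qed
  have "norm (g 1 - g 0) \<le> (2 * e * t\<^sup>2 * ?N * norm v) * norm (1 - 0 :: real)"
  proof (rule differentiable_bound[where S = "{0..1}" and f' = "\<lambda>s x. x *\<^sub>R g' s"])
    show "onorm (\<lambda>x. x *\<^sub>R g' s) \<le> 2 * e * t\<^sup>2 * ?N * norm v" if "s \<in> {0..1}" for s
      using bound[OF that] by (intro onorm_le) (simp add: mult.commute mult_left_mono)
  qed (use der in auto)
  then show ?thesis by (simp add: g_def algebra_simps)
qed

text \<open>One and the same second difference approximates t^2 \<open>L w v\<close> and, with the
  directions exchanged, t^2 \<open>L v w\<close>, each up to a multiple of e t^2. Dividing by t^2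
  and letting e tend to 0 gives equality.\<close>

lemma second_derivative_symmetric:
  fixes u :: "complex \<Rightarrow> complex" and u' :: "complex \<Rightarrow> complex \<Rightarrow>\<^sub>L complex"
    and L :: "complex \<Rightarrow>\<^sub>L (complex \<Rightarrow>\<^sub>L complex)"
  assumes S: "open S" "z \<in> S"
    and du: "\<And>x. x \<in> S \<Longrightarrow> (u has_derivative blinfun_apply (u' x)) (at x)"
    and L: "(u' has_derivative blinfun_apply L) (at z)"
  shows "L v w = L w v"
proof -
  define N where "N = norm v + norm w"
  have N: "N \<ge> 0" by (simp add: N_def)
  have "norm (L v w - L w v) \<le> e * (2 * N\<^sup>2)" if e: "e > 0" for e
  proof -
    obtain r where r: "r > 0" "ball z r \<subseteq> S" using S open_contains_ball by blast
    obtain d where d: "d > 0" "\<And>y. norm (y - z) < d \<Longrightarrow> norm (u' y - u' z - L (y - z)) \<le> e * norm (y - z)"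
      using L e unfolding has_derivative_at_alt by blast
    define m where "m = min d r"
    have m: "m > 0" using d r by (auto simp: m_def)
    have A: "(u has_derivative blinfun_apply (u' (z + h))) (at (z + h))" if "norm h < m" for h
      using that r by (intro du) (auto simp: m_def dist_norm subset_iff)
    have B: "norm (u' (z + h) - u' z - L h) \<le> e * norm h" if "norm h < m" for h
      using d(2)[of "z + h"] that by (auto simp: m_def)
    \<comment> \<open>Any positive \<open>t\<close> with \<open>t * N < m\<close> would do; the
      summand 1 covers the case \<open>v = w = 0\<close>.\<close>
    define t where "t = m / (2 * (N + 1))"
    have t: "t > 0" using m N by (auto simp: t_def)
    have "N / (2 * (N + 1)) < 1" using N by (simp add: divide_simps)
    from mult_strict_left_mono[OF this m] have tN: "t * N < m" by (simp add: t_def)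
    define D where "D = u (z + t *\<^sub>R v + t *\<^sub>R w) - u (z + t *\<^sub>R v) - u (z + t *\<^sub>R w) + u z"
    have 1: "norm (D - t\<^sup>2 *\<^sub>R L w v) \<le> 2 * e * t\<^sup>2 * N * norm v"
      using second_difference_bound[OF A B t, where v = v and w = w] tN e by (simp add: D_def N_def)
    have 2: "norm (D - t\<^sup>2 *\<^sub>R L v w) \<le> 2 * e * t\<^sup>2 * N * norm w"
      using second_difference_bound[OF A B t, where v = w and w = v] tN e by (simp add: D_def N_def algebra_simps)
    have "norm (t\<^sup>2 *\<^sub>R (L v w - L w v)) = norm ((D - t\<^sup>2 *\<^sub>R L w v) - (D - t\<^sup>2 *\<^sub>R L v w))"
      by (simp add: algebra_simps)
    also have "\<dots> \<le> 2 * e * t\<^sup>2 * N * norm v + 2 * e * t\<^sup>2 * N * norm w"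
      by (rule norm_triangle_le_diff[OF add_mono[OF 1 2]])
    also have "\<dots> = t\<^sup>2 * (e * (2 * N\<^sup>2))"
      by (simp add: N_def algebra_simps power2_eq_square)
    finally have "t\<^sup>2 * norm (L v w - L w v) \<le> t\<^sup>2 * (e * (2 * N\<^sup>2))" by simp
    then show ?thesis using t by simp
  qed
  then have le: "norm (L v w - L w v) \<le> e * (2 * N\<^sup>2)" if "e > 0" for e using that by blast
  have "norm (L v w - L w v) \<le> 0"
  proof (rule field_le_epsilon)
    fix x :: real assume x: "x > 0"
    have "norm (L v w - L w v) \<le> (x / (2 * N\<^sup>2 + 1)) * (2 * N\<^sup>2)"
      using x by (intro le divide_pos_pos) (auto intro: add_nonneg_pos)
    also have "\<dots> \<le> x"
    proof -
      have "2 * N\<^sup>2 + 1 > 0" by (auto intro: add_nonneg_pos)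
      then show ?thesis using x by (simp add: divide_simps mult_left_mono)
    qed
    finally show "norm (L v w - L w v) \<le> 0 + x" by simp
  qed
  then show ?thesis by simp
qed

text \<open>\<open>F\<close> is a primitive of \<open>\<partial>u = (u\<^sub>x - \<i> u\<^sub>y) / 2\<close>, which is holomorphic because the Laplacian of \<open>u\<close> vanishes.\<close>

lemma harmonic_on_decompose:
  assumes "harmonic_on u (ball 0 1)"
  obtains F G where "F holomorphic_on ball 0 1" "G holomorphic_on ball 0 1"
    "\<And>z. z \<in> ball 0 1 \<Longrightarrow> u z = F z + cnj (G z)"
proof -
  obtain u' u'' where u': "\<And>z. z \<in> ball 0 1 \<Longrightarrow> (u has_derivative blinfun_apply (u' z)) (at z)"
    and u'': "\<And>z. z \<in> ball 0 1 \<Longrightarrow> (u' has_derivative blinfun_apply (u'' z)) (at z)"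
    and lap: "\<And>z. z \<in> ball 0 1 \<Longrightarrow> blinfun_apply (blinfun_apply (u'' z) 1) 1 + blinfun_apply (blinfun_apply (u'' z) \<i>) \<i> = 0"
    using assms unfolding harmonic_on_def by blast
  have lin: "blinfun_apply M h = of_real (Re h) * M 1 + of_real (Im h) * M \<i>" for M :: "complex \<Rightarrow>\<^sub>L complex" and h
  proof -
    have "h = Re h *\<^sub>R 1 + Im h *\<^sub>R \<i>" by (simp add: complex_eq_iff)
    then have "blinfun_apply M h = M (Re h *\<^sub>R 1 + Im h *\<^sub>R \<i>)" by (rule arg_cong)
    also have "\<dots> = Re h *\<^sub>R M 1 + Im h *\<^sub>R M \<i>"
      by (simp only: blinfun.add_right blinfun.scaleR_right)
    finally show ?thesis by (simp only: scaleR_conv_of_real)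
  qed
  have lin2: "blinfun_apply (blinfun_apply M h) k = of_real (Re h) * M 1 k + of_real (Im h) * M \<i> k" for M :: "complex \<Rightarrow>\<^sub>L (complex \<Rightarrow>\<^sub>L complex)" and h k
  proof -
    have "h = Re h *\<^sub>R 1 + Im h *\<^sub>R \<i>" by (simp add: complex_eq_iff)
    then have "blinfun_apply M h = M (Re h *\<^sub>R 1 + Im h *\<^sub>R \<i>)" by (rule arg_cong)
    also have "\<dots> = Re h *\<^sub>R M 1 + Im h *\<^sub>R M \<i>"
      by (simp only: blinfun.add_right blinfun.scaleR_right)
    finally show ?thesis by (simp only: blinfun.scaleR_left blinfun.add_left scaleR_conv_of_real)
  qed
  define a where "a z = (u' z 1 - \<i> * u' z \<i>) / 2" for z
  have hol_a: "a holomorphic_on ball 0 1"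
  proof (subst holomorphic_on_open, simp, intro ballI)
    fix z :: complex assume z: "z \<in> ball 0 1"
    have sym: "u'' z \<i> 1 = u'' z 1 \<i>"
      by (rule second_derivative_symmetric[OF open_ball z u' u''[OF z]])
    have d: "(a has_derivative (\<lambda>h. (u'' z h 1 - \<i> * u'' z h \<i>) / 2)) (at z)"
      unfolding a_def[abs_def] by (auto intro!: derivative_eq_intros u''[OF z] simp: blinfun.zero_right)
    \<comment> \<open>Symmetry together with the Laplace equation amounts to the Cauchy-Riemann
      equations for \<open>a\<close>: they make its real derivative complex linear.\<close>
    have eq: "(u'' z h 1 - \<i> * u'' z h \<i>) / 2 = (u'' z 1 1 - \<i> * u'' z 1 \<i>) / 2 * h" for h
    proof -
      have ii: "u'' z \<i> \<i> = - u'' z 1 1" using lap[OF z] by (simp add: add_eq_0_iff)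
      show ?thesis unfolding lin2[of _ h] sym ii
        by (subst (3) complex_eq[of h]) (simp add: field_simps)
    qed
    show "\<exists>f'. (a has_field_derivative f') (at z)"
      unfolding has_field_derivative_def
      by (rule exI, rule has_derivative_eq_rhs[OF d], rule ext, rule eq)
  qed
  obtain F where "\<And>z. z \<in> ball 0 1 \<Longrightarrow> (F has_field_derivative a z) (at z within ball 0 1)"
    using holomorphic_convex_primitive'[OF convex_ball open_ball hol_a] by blast
  then have F: "(F has_field_derivative a z) (at z)" if "z \<in> ball 0 1" for z
    using that at_within_open[OF that open_ball] by force
  define G where "G z = cnj (u z - F z)" for z
  have "G holomorphic_on ball 0 1"
  proof (subst holomorphic_on_open, simp, intro ballI)
    fix z :: complex assume z: "z \<in> ball 0 1"
    have "((\<lambda>z. u z - F z) has_derivative (\<lambda>h. u' z h - a z * h)) (at z)"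
      using F[OF z] u'[OF z] unfolding has_field_derivative_def by (rule has_derivative_diff[rotated])
    from has_derivative_compose[OF this has_derivative_cnj[OF has_derivative_ident]] have d: "(G has_derivative (\<lambda>h. cnj (u' z h - a z * h))) (at z)"
      unfolding G_def[abs_def] .
    \<comment> \<open>\<open>F\<close> absorbs the complex linear part of the derivative of
      \<open>u\<close>. What remains is conjugate linear, so the conjugate \<open>G\<close> of
      \<open>u - F\<close> is holomorphic.\<close>
    have eq: "cnj (u' z h - a z * h) = cnj ((u' z 1 + \<i> * u' z \<i>) / 2) * h" for h
    proof -
      have "u' z h - a z * h = ((u' z 1 + \<i> * u' z \<i>) / 2) * cnj h"
        unfolding lin[of _ h] a_def
        by (subst (3) complex_eq[of h], subst (3) complex_eq[of h]) (simp add: field_simps)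
      from arg_cong[OF this, of cnj] show ?thesis
        by (simp only: complex_cnj_mult complex_cnj_cnj)
    qed
    show "\<exists>f'. (G has_field_derivative f') (at z)"
      unfolding has_field_derivative_def
      by (rule exI, rule has_derivative_eq_rhs[OF d], rule ext, rule eq)
  qed
  moreover have "F holomorphic_on ball 0 1"
    using F holomorphic_on_open[OF open_ball] by blast
  ultimately show ?thesis by (intro that[of F G]) (auto simp: G_def)
qed

text \<open>The second derivative sends (h, k) to f''(z) h k, and the Laplacian vanishes because the
  squares of 1 and \<open>\<i>\<close> add up to 0. \<open>M\<close> packages multiplication as a
  bounded linear map into operators, so that the second derivative becomes a composition.\<close>

lemma harmonic_on_holomorphic:
  assumes f: "f holomorphic_on S" and S: "open S"
  shows "harmonic_on f S"
proof -
  define M :: "complex \<Rightarrow>\<^sub>L (complex \<Rightarrow>\<^sub>L complex)" where "M = Blinfun blinfun_mult_right"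
  have M: "blinfun_apply M = blinfun_mult_right"
    unfolding M_def by (rule bounded_linear_Blinfun_apply[OF bounded_linear_blinfun_mult_right])
  have d1: "(f has_field_derivative deriv f z) (at z)" if "z \<in> S" for z
    using holomorphic_derivI[OF f S that] .
  have f': "deriv f holomorphic_on S" using holomorphic_deriv[OF f S] .
  have d2: "(deriv f has_field_derivative deriv (deriv f) z) (at z)" if "z \<in> S" for z
    using holomorphic_derivI[OF f' S that] .
  have c: "continuous_on S (deriv (deriv f))"
    using holomorphic_deriv[OF f' S] holomorphic_on_imp_continuous_on by blast
  show ?thesis
    unfolding harmonic_on_def
  proof (intro exI[of _ "\<lambda>z. blinfun_mult_right (deriv f z)"] exI[of _ "\<lambda>z. M o\<^sub>L blinfun_mult_right (deriv (deriv f) z)"] conjI ballI)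
    fix z assume z: "z \<in> S"
    show "(f has_derivative blinfun_apply (blinfun_mult_right (deriv f z))) (at z)"
      using d1[OF z] by (simp add: has_field_derivative_def)
    show "((\<lambda>z. blinfun_mult_right (deriv f z)) has_derivative blinfun_apply (M o\<^sub>L blinfun_mult_right (deriv (deriv f) z))) (at z)"
      using bounded_linear.has_derivative[OF bounded_linear_blinfun_mult_right d2[OF z, unfolded has_field_derivative_def]]
      by (simp add: M blinfun_compose.rep_eq o_def)
    show "(M o\<^sub>L blinfun_mult_right (deriv (deriv f) z)) 1 1 + (M o\<^sub>L blinfun_mult_right (deriv (deriv f) z)) \<i> \<i> = 0"
      by (simp add: M mult.assoc)
  next
    show "continuous_on S (\<lambda>z. M o\<^sub>L blinfun_mult_right (deriv (deriv f) z))"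
      by (intro continuous_intros c bounded_linear.continuous_on[OF bounded_linear_blinfun_mult_right])
  qed
qed

lemma harmonic_on_cnj:
  assumes "harmonic_on u S"
  shows "harmonic_on (\<lambda>z. cnj (u z)) S"
proof -
  obtain u' u'' where u': "\<And>z. z \<in> S \<Longrightarrow> (u has_derivative blinfun_apply (u' z)) (at z)"
    and u'': "\<And>z. z \<in> S \<Longrightarrow> (u' has_derivative blinfun_apply (u'' z)) (at z)"
    and c: "continuous_on S u''"
    and lap: "\<And>z. z \<in> S \<Longrightarrow> blinfun_apply (blinfun_apply (u'' z) 1) 1 + blinfun_apply (blinfun_apply (u'' z) \<i>) \<i> = 0"
    using assms unfolding harmonic_on_def by blast
  define C :: "complex \<Rightarrow>\<^sub>L complex" where "C = Blinfun cnj"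
  have C: "blinfun_apply C = cnj"
    unfolding C_def by (rule bounded_linear_Blinfun_apply[OF bounded_linear_cnj])
  have blC: "bounded_linear (\<lambda>A :: complex \<Rightarrow>\<^sub>L complex. C o\<^sub>L A)" 
    by (rule bounded_bilinear.bounded_linear_right[OF bounded_bilinear_blinfun_compose])
  define P where "P = Blinfun (\<lambda>A :: complex \<Rightarrow>\<^sub>L complex. C o\<^sub>L A)"
  have P: "blinfun_apply P = (\<lambda>A. C o\<^sub>L A)"
    unfolding P_def by (rule bounded_linear_Blinfun_apply[OF blC])
  show ?thesis
    unfolding harmonic_on_def
  proof (intro exI[of _ "\<lambda>z. C o\<^sub>L u' z"] exI[of _ "\<lambda>z. P o\<^sub>L u'' z"] conjI ballI)
    fix z assume z: "z \<in> S"
    show "((\<lambda>z. cnj (u z)) has_derivative blinfun_apply (C o\<^sub>L u' z)) (at z)"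
      using bounded_linear.has_derivative[OF bounded_linear_cnj u'[OF z]] by (simp add: C blinfun_compose.rep_eq o_def)
    show "((\<lambda>z. C o\<^sub>L u' z) has_derivative blinfun_apply (P o\<^sub>L u'' z)) (at z)"
      using bounded_linear.has_derivative[OF blC u''[OF z]] by (simp add: P blinfun_compose.rep_eq o_def)
    show "(P o\<^sub>L u'' z) 1 1 + (P o\<^sub>L u'' z) \<i> \<i> = 0"
      using arg_cong[OF lap[OF z], of cnj] by (simp add: P C)
  next
    show "continuous_on S (\<lambda>z. P o\<^sub>L u'' z)" by (intro continuous_intros c)
  qed
qed

lemma harmonic_on_add:
  assumes "harmonic_on u S" "harmonic_on v S"
  shows "harmonic_on (\<lambda>z. u z + v z) S"
proof -
  obtain u' u'' where u: "\<And>z. z \<in> S \<Longrightarrow> (u has_derivative blinfun_apply (u' z)) (at z)"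
    "\<And>z. z \<in> S \<Longrightarrow> (u' has_derivative blinfun_apply (u'' z)) (at z)" "continuous_on S u''"
    "\<And>z. z \<in> S \<Longrightarrow> blinfun_apply (blinfun_apply (u'' z) 1) 1 + blinfun_apply (blinfun_apply (u'' z) \<i>) \<i> = 0"
    using assms(1) unfolding harmonic_on_def by blast
  obtain v' v'' where v: "\<And>z. z \<in> S \<Longrightarrow> (v has_derivative blinfun_apply (v' z)) (at z)"
    "\<And>z. z \<in> S \<Longrightarrow> (v' has_derivative blinfun_apply (v'' z)) (at z)" "continuous_on S v''"
    "\<And>z. z \<in> S \<Longrightarrow> blinfun_apply (blinfun_apply (v'' z) 1) 1 + blinfun_apply (blinfun_apply (v'' z) \<i>) \<i> = 0"
    using assms(2) unfolding harmonic_on_def by blast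
  have b: "blinfun_apply (a + b) = (\<lambda>h. blinfun_apply a h + blinfun_apply b h)" for a b :: "'x::real_normed_vector \<Rightarrow>\<^sub>L 'y::real_normed_vector"
    by (simp add: fun_eq_iff blinfun.add_left)
  show ?thesis
    unfolding harmonic_on_def
  proof (intro exI[of _ "\<lambda>z. u' z + v' z"] exI[of _ "\<lambda>z. u'' z + v'' z"] conjI ballI)
    fix z assume z: "z \<in> S"
    show "((\<lambda>z. u z + v z) has_derivative blinfun_apply (u' z + v' z)) (at z)"
      unfolding b by (intro has_derivative_add u v z)
    show "((\<lambda>z. u' z + v' z) has_derivative blinfun_apply (u'' z + v'' z)) (at z)"
      unfolding b by (intro has_derivative_add u v z)
    show "(u'' z + v'' z) 1 1 + (u'' z + v'' z) \<i> \<i> = 0"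
      using u(4)[OF z] v(4)[OF z] by (simp add: b algebra_simps)
  next
    show "continuous_on S (\<lambda>z. u'' z + v'' z)" by (intro continuous_intros u v)
  qed
qed

lemma harmonic_on_cong:
  assumes S: "open S" and eq: "\<And>z. z \<in> S \<Longrightarrow> u z = v z" and "harmonic_on u S"
  shows "harmonic_on v S"
proof -
  have D: "(v has_derivative D) (at z)" if "(u has_derivative D) (at z)" "z \<in> S" for D z
    using has_derivative_transform_within_open[OF that(1) S that(2)] eq by blast
  obtain u' u'' where "\<And>z. z \<in> S \<Longrightarrow> (u has_derivative blinfun_apply (u' z)) (at z)"
    and "\<forall>z\<in>S. (u' has_derivative blinfun_apply (u'' z)) (at z)" "continuous_on S u''"
    "\<forall>z\<in>S. blinfun_apply (blinfun_apply (u'' z) 1) 1 + blinfun_apply (blinfun_apply (u'' z) \<i>) \<i> = 0"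
    using assms(3) unfolding harmonic_on_def by blast
  then show ?thesis
    unfolding harmonic_on_def by (intro exI[of _ u'] exI[of _ u''] conjI ballI D) auto
qed


subsection \<open>The reproducing kernel\<close>

text \<open>\<open>angular m (r e\<^sup>i\<^sup>\<theta>) = r\<^bsup>|m|\<^esup> e\<^bsup>im\<theta>\<^esup>\<close>.\<close>

definition angular :: "int \<Rightarrow> complex \<Rightarrow> complex" where
  "angular m w = (if m \<ge> 0 then w ^ nat m else cnj w ^ nat (- m))"

lemma angular_simps [simp]:
  "angular 0 w = 1" "angular (int n) w = w ^ n" "angular (- int n) w = cnj w ^ n"
  by (auto simp: angular_def)

lemma cnj_measurable [measurable]: "cnj \<in> borel_measurable borel"
  by (intro borel_measurable_continuous_onI continuous_intros)

lemma angular_measurable [measurable]: "angular m \<in> borel_measurable borel"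
  unfolding angular_def[abs_def] by (cases "m \<ge> 0") (auto intro!: borel_measurable_continuous_onI continuous_intros)

lemma norm_angular: "cmod (angular m w) = cmod w ^ nat \<bar>m\<bar>"
  by (auto simp: angular_def norm_power)

lemma angular_mult: "angular m (v * w) = angular m v * angular m w"
  by (auto simp: angular_def power_mult_distrib)

lemma angular_of_real: "angular m (of_real x) = of_real x ^ nat \<bar>m\<bar>"
  by (auto simp: angular_def)

lemma angular_cis: "angular m (cis t) = cis (of_int m * t)"
  unfolding angular_def cis_cnj Complex.DeMoivre by auto

lemma angular_add_sgn:
  assumes "w \<noteq> 0"
  shows "angular m (sgn w) * angular n (sgn w) = angular (m + n) (sgn w)"
proof -
  have "sgn w = cis (Arg w)" using assms by (simp add: cis_Arg)
  then show ?thesis by (simp add: angular_cis cis_mult algebra_simps)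
qed

lemma angular_polar: "angular m w = angular m (sgn w) * of_real (cmod w ^ nat \<bar>m\<bar>)"
proof -
  have "w = sgn w * of_real (cmod w)" by (simp add: sgn_eq)
  then have "angular m w = angular m (sgn w * of_real (cmod w))" by simp
  then show ?thesis by (simp add: angular_mult angular_of_real)
qed

text \<open>The first two summands are the Bergman kernel of the holomorphic functions and its
  conjugate. Constants belong to both families, so one copy of their kernel 1 is removed.\<close>

definition bergman_kernel :: "complex \<Rightarrow> complex \<Rightarrow> complex" where
  "bergman_kernel z w = 1 / (1 - z * cnj w)\<^sup>2 + 1 / (1 - cnj z * w)\<^sup>2 - 1"

lemma cnj_bergman_kernel: "cnj (bergman_kernel z w) = bergman_kernel z w"
  by (simp add: bergman_kernel_def)

lemma bergman_kernel_sym: "bergman_kernel z w = bergman_kernel w z"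
  by (simp add: bergman_kernel_def mult.commute)

lemma bergman_kernel_measurable [measurable]: "bergman_kernel z \<in> borel_measurable borel"
  unfolding bergman_kernel_def[abs_def] by measurable

definition kernel_term :: "complex \<Rightarrow> complex \<Rightarrow> int \<Rightarrow> complex" where
  "kernel_term z w k = of_int (\<bar>k\<bar> + 1) * angular k z * cnj (angular k w)"

lemma norm_kernel_term:
  "cmod w \<le> 1 \<Longrightarrow> cmod (kernel_term z w k) \<le> of_int (\<bar>k\<bar> + 1) * cmod z ^ nat \<bar>k\<bar>"
  unfolding kernel_term_def norm_mult norm_of_int complex_mod_cnj norm_angular
  by (auto intro!: mult_right_le_one_le power_le_one)

lemma sums_Suc_mult_power:
  fixes x :: "'a :: {real_normed_field, banach}"
  assumes "norm x < 1"
  shows "(\<lambda>k. of_nat (k + 1) * x ^ k) sums (1 / (1 - x)\<^sup>2)"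
  using geometric_deriv_sums[OF assms] by (simp add: add.commute)

text \<open>Pairing j with -(j+1) runs through the integers exactly once. The negative indices give
  the second series without its constant term, which accounts for the \<open>- 1\<close> in the
  kernel.\<close>

lemma bergman_kernel_sums:
  assumes z: "cmod z < 1" and w: "cmod w \<le> 1"
  shows "(\<lambda>j. kernel_term z w (int j) + kernel_term z w (- int (Suc j))) sums bergman_kernel z w"
proof -
  have n: "cmod (z * cnj w) < 1" "cmod (cnj z * w) < 1"
    using mult_mono[of "cmod z" "cmod z" "cmod w" 1] z w by (auto simp: norm_mult)
  have 1: "(\<lambda>j. kernel_term z w (int j)) sums (1 / (1 - z * cnj w)\<^sup>2)"
    using sums_Suc_mult_power[OF n(1)] by (simp add: kernel_term_def power_mult_distrib mult.assoc add.commute)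
  have "(\<lambda>j. of_nat (Suc j + 1) * (cnj z * w) ^ Suc j) sums (1 / (1 - cnj z * w)\<^sup>2 - 1)"
    using sums_Suc_mult_power[OF n(2)] by (subst sums_Suc_iff) simp
  also have "(\<lambda>j. of_nat (Suc j + 1) * (cnj z * w) ^ Suc j) = (\<lambda>j. kernel_term z w (- int (Suc j)))"
  proof
    fix j
    have "angular (- int (Suc j)) z = cnj z ^ Suc j" "angular (- int (Suc j)) w = cnj w ^ Suc j"
      by (simp_all only: angular_simps)
    then show "of_nat (Suc j + 1) * (cnj z * w) ^ Suc j = kernel_term z w (- int (Suc j))"
      by (simp add: kernel_term_def power_mult_distrib mult.assoc)
  qed
  finally have "(\<lambda>j. kernel_term z w (int j) + kernel_term z w (- int (Suc j))) sums
      (1 / (1 - z * cnj w)\<^sup>2 + (1 / (1 - cnj z * w)\<^sup>2 - 1))"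
    by (intro sums_add 1)
  then show ?thesis by (simp only: bergman_kernel_def add_diff_eq)
qed

lemma bergman_kernel_bounded:
  assumes z: "cmod z < 1"
  obtains B where "\<And>w. cmod w \<le> 1 \<Longrightarrow> cmod (bergman_kernel z w) \<le> B"
proof -
  have "continuous_on (cball 0 1) (bergman_kernel z)"
  proof -
    have "z * cnj w \<noteq> 1" "cnj z * w \<noteq> 1" if "w \<in> cball 0 1" for w
    proof -
      have "cmod (z * cnj w) < 1" "cmod (cnj z * w) < 1"
        using mult_mono[of "cmod z" "cmod z" "cmod w" 1] z that by (auto simp: norm_mult)
      then show "z * cnj w \<noteq> 1" "cnj z * w \<noteq> 1" by auto
    qed
    then show ?thesis unfolding bergman_kernel_def[abs_def]
      by (intro continuous_intros) auto
  qed
  then have "bounded (bergman_kernel z ` cball 0 1)"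
    by (intro compact_imp_bounded compact_continuous_image) auto
  then obtain B where "\<forall>x\<in>bergman_kernel z ` cball 0 1. norm x \<le> B" unfolding bounded_iff by blast
  then show ?thesis by (intro that[of B]) auto
qed

section \<open>Integration of homogeneous functions against the kernel\<close>

lemma space_disk_measure [simp]: "space disk_measure = ball 0 1"
  by (simp add: disk_measure_def)

lemma borel_measurable_disk_measure:
  assumes "f \<in> borel_measurable borel"
  shows "f \<in> borel_measurable disk_measure"
  using assms unfolding disk_measure_def
  by (auto intro!: measurable_restrict_space1 measurable_completion)

lemma integrable_disk_mult_bounded:
  fixes f g :: "complex \<Rightarrow> complex"
  assumes f: "integrable disk_measure f" and g: "g \<in> borel_measurable borel"
    and B: "\<And>w. cmod w < 1 \<Longrightarrow> cmod (g w) \<le> B"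
  shows "integrable disk_measure (\<lambda>w. f w * g w)"
proof (rule Bochner_Integration.integrable_bound)
  show "integrable disk_measure (\<lambda>w. B *\<^sub>R f w)" using f by simp
  show "(\<lambda>w. f w * g w) \<in> borel_measurable disk_measure"
    using borel_measurable_integrable[OF f] borel_measurable_disk_measure[OF g] by simp
  show "AE w in disk_measure. norm (f w * g w) \<le> norm (B *\<^sub>R f w)"
  proof (rule AE_I2)
    fix w assume "w \<in> space disk_measure"
    then have b: "cmod (g w) \<le> B" by (intro B) simp
    then have "0 \<le> B" using norm_ge_zero order_trans by blast
    with b show "norm (f w * g w) \<le> norm (B *\<^sub>R f w)"
      by (simp add: norm_mult mult.commute[of "cmod (f w)"] mult_right_mono)
  qed
qed

text \<open>When the kernel series is integrated term by term, \<open>g\<close> times the k-th term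
  has angular degree m - k, so rotation kills every k other than m. For |w| < 1 the k-th term is at
  most (|k|+1) |z|^|k|, which is summable; integrability of \<open>g\<close> therefore suffices for
  the interchange.\<close>

lemma integral_bergman_kernel_homogeneous:
  fixes g :: "complex \<Rightarrow> complex"
  assumes g: "g \<in> borel_measurable borel" "integrable disk_measure g"
    and hom: "\<And>t w. g (cis t * w) = cis (of_int m * t) * g w" and z: "cmod z < 1"
  shows "(LINT w|disk_measure. g w * bergman_kernel z w)
           = of_int (\<bar>m\<bar> + 1) * angular m z * (LINT w|disk_measure. g w * cnj (angular m w))"
proof -
  define T where "T j w = g w * (kernel_term z w (int j) + kernel_term z w (- int (Suc j)))" for j w
  have [measurable]: "(\<lambda>w. kernel_term z w k) \<in> borel_measurable borel" for k
    unfolding kernel_term_def[abs_def] by measurable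
  have int: "integrable disk_measure (\<lambda>w. g w * kernel_term z w k)" for k
    by (rule integrable_disk_mult_bounded[OF g(2) _ norm_kernel_term]) auto
  define c where "c = of_int (\<bar>m\<bar> + 1) * angular m z * (LINT w|disk_measure. g w * cnj (angular m w))"
  have coeff: "(LINT w|disk_measure. g w * kernel_term z w k) = (if k = m then c else 0)" for k
  proof (cases "k = m")
    case True
    have "(LINT w|disk_measure. g w * kernel_term z w k) =
        (LINT w|disk_measure. (of_int (\<bar>m\<bar> + 1) * angular m z) * (g w * cnj (angular m w)))"
      using True by (simp add: kernel_term_def mult_ac)
    also have "\<dots> = c" unfolding c_def by (rule integral_mult_right_zero)
    finally show ?thesis using True by simp
  next
    case False
    have "(LINT w|disk_measure. g w * kernel_term z w k) = 0"
    proof (rule integral_disk_homogeneous_eq_0)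
      show "m - k \<noteq> 0" using False by simp
      show "(\<lambda>w. g w * kernel_term z w k) \<in> borel_measurable borel" using g by measurable
      show "g (cis t * w) * kernel_term z (cis t * w) k = cis (of_int (m - k) * t) * (g w * kernel_term z w k)" for t w
      proof -
        have "cnj (cis (of_int k * t)) = cis (- (of_int k * t))" by (simp add: cis_cnj)
        then have "cis (of_int m * t) * cnj (cis (of_int k * t)) = cis (of_int (m - k) * t)"
          by (simp add: cis_mult algebra_simps)
        then have R: "cis (of_int (m - k) * t) = cis (of_int m * t) * cnj (cis (of_int k * t))" by simp
        show ?thesis unfolding kernel_term_def hom angular_mult angular_cis complex_cnj_mult R
          by (simp only: mult_ac)
      qed
    qed
    then show ?thesis using False by simp
  qed
  have T: "integrable disk_measure (T j)" for j
    unfolding T_def[abs_def] distrib_left by (intro Bochner_Integration.integrable_add int)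
  \<comment> \<open>The distinguished value of j is the position of the pair (j, -(j+1)) that
    contains \<open>m\<close>.\<close>
  have intT: "(LINT w|disk_measure. T j w) = (if j = nat (if m \<ge> 0 then m else - m - 1) then c else 0)" for j
  proof -
    have "(LINT w|disk_measure. T j w) = (if int j = m then c else 0) + (if - int (Suc j) = m then c else 0)"
      unfolding T_def[abs_def] distrib_left coeff[symmetric] by (rule Bochner_Integration.integral_add[OF int int])
    then show ?thesis by (auto simp: nat_eq_iff split: if_splits)
  qed
  define b where "b j = real (j + 1) * cmod z ^ j + real (Suc j + 1) * cmod z ^ Suc j" for j
  have b: "summable b"
  proof -
    have "summable (\<lambda>j. real (j + 1) * cmod z ^ j)"
      using sums_Suc_mult_power[of "cmod z"] z by (auto simp: sums_iff)
    moreover from this have "summable (\<lambda>j. real (Suc j + 1) * cmod z ^ Suc j)"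
      by (subst (asm) summable_Suc_iff[symmetric])
    ultimately show ?thesis unfolding b_def[abs_def] by (rule summable_add)
  qed
  have bound: "norm (T j w) \<le> b j * cmod (g w)" if "w \<in> ball 0 1" for j w
  proof -
    have "cmod (kernel_term z w (int j) + kernel_term z w (- int (Suc j))) \<le> b j"
      using norm_kernel_term[of w z "int j"] norm_kernel_term[of w z "- int (Suc j)"] that
      by (intro norm_triangle_le) (auto simp: b_def nat_add_distrib algebra_simps)
    then show ?thesis
      unfolding T_def norm_mult by (subst mult.commute) (rule mult_right_mono, simp_all)
  qed
  have "(\<lambda>j. LINT w|disk_measure. T j w) sums (LINT w|disk_measure. (\<Sum>j. T j w))"
  proof (rule sums_integral)
    show "AE w in disk_measure. summable (\<lambda>j. norm (T j w))"
      by (rule AE_I2, rule summable_comparison_test'[where N = 0, OF summable_mult2[OF b]]) (use bound in auto)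
    show "summable (\<lambda>j. LINT w|disk_measure. norm (T j w))"
    proof (rule summable_comparison_test'[where N = 0, OF summable_mult2[OF b]])
      fix j :: nat
      have "(LINT w|disk_measure. norm (T j w)) \<le> (LINT w|disk_measure. b j * cmod (g w))"
        using bound T g by (intro integral_mono) auto
      then show "norm (LINT w|disk_measure. norm (T j w)) \<le> b j * (LINT w|disk_measure. cmod (g w))"
        by simp
    qed
  qed (rule T)
  moreover have "(\<lambda>j. LINT w|disk_measure. T j w) sums c"
    unfolding intT using sums_single[of _ "\<lambda>_. c"] by simp
  ultimately have "(LINT w|disk_measure. (\<Sum>j. T j w)) = c" by (rule sums_unique2)
  moreover have "(LINT w|disk_measure. (\<Sum>j. T j w)) = (LINT w|disk_measure. g w * bergman_kernel z w)"
  proof (rule Bochner_Integration.integral_cong)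
    fix w assume "w \<in> space disk_measure"
    then have "(\<lambda>j. T j w) sums (g w * bergman_kernel z w)"
      unfolding T_def using z by (intro sums_mult bergman_kernel_sums) auto
    then show "(\<Sum>j. T j w) = g w * bergman_kernel z w" by (simp add: sums_iff)
  qed simp
  ultimately show ?thesis by (simp add: c_def)
qed

text \<open>The conjugate of \<open>angular m\<close> cancels the angular factor and leaves r^|m|;
  the radial distribution 2 r dr contributes the factor 2 and one more power of r.\<close>

lemma integral_bergman_kernel_radial:
  fixes f :: "real \<Rightarrow> complex"
  assumes f[measurable]: "f \<in> borel_measurable borel" and 0: "\<And>r. r \<notin> {0<..<1} \<Longrightarrow> f r = 0"
    and int: "integrable lborel (\<lambda>r. r *\<^sub>R f r)" and z: "cmod z < 1"
  shows "integrable disk_measure (\<lambda>w. f (cmod w) * angular m (sgn w))"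
    and "(LINT w|disk_measure. f (cmod w) * angular m (sgn w) * bergman_kernel z w)
           = 2 * of_int (\<bar>m\<bar> + 1) * angular m z * (LINT r|lborel. of_real (r ^ nat (\<bar>m\<bar> + 1)) * f r)"
proof -
  let ?g = "\<lambda>w. f (cmod w) * angular m (sgn w)"
  have [measurable]: "sgn \<in> borel_measurable (borel :: complex measure)"
    unfolding sgn_div_norm[abs_def] by measurable
  have gm: "?g \<in> borel_measurable borel" by measurable
  show gi: "integrable disk_measure ?g"
    using int disk_integral_radial(1)[OF f] integrable_radial_density(1)[OF f 0]
    by (intro integrable_disk_mult_bounded[where B = 1])
      (auto simp: norm_angular norm_sgn power_0_left)
  have hom: "?g (cis t * w) = cis (of_int m * t) * ?g w" for t w
  proof -
    have "sgn (cis t * w) = cis t * sgn w" by (simp add: sgn_eq norm_mult)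
    then show ?thesis by (simp add: norm_mult angular_mult angular_cis)
  qed
  have "(LINT w|disk_measure. ?g w * bergman_kernel z w) =
      of_int (\<bar>m\<bar> + 1) * angular m z * (LINT w|disk_measure. ?g w * cnj (angular m w))"
    by (rule integral_bergman_kernel_homogeneous[OF gm gi hom z])
  also have "(LINT w|disk_measure. ?g w * cnj (angular m w)) = (LINT w|disk_measure. of_real (cmod w ^ nat \<bar>m\<bar>) * f (cmod w))"
  proof (rule Bochner_Integration.integral_cong)
    fix w :: complex
    have "angular m (sgn w) * cnj (angular m (sgn w)) = 1" if "w \<noteq> 0"
      using that unfolding complex_norm_square[symmetric] norm_angular by (simp add: norm_sgn)
    \<comment> \<open>At the origin \<open>sgn\<close> is 0 and the cancellation above may fail, but
      there \<open>f\<close> vanishes.\<close>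
    moreover have "f (cmod w) = 0" if "w = 0" using that 0[of 0] by simp
    ultimately show "?g w * cnj (angular m w) = of_real (cmod w ^ nat \<bar>m\<bar>) * f (cmod w)"
      by (subst (2) angular_polar) (cases "w = 0"; simp add: mult_ac)
  qed simp
  also have "\<dots> = 2 * (LINT r|lborel. r *\<^sub>R (of_real (r ^ nat \<bar>m\<bar>) * f r))"
    using 0 by (subst disk_integral_radial(2), simp, subst integrable_radial_density(2)) auto
  also have "(\<lambda>r. r *\<^sub>R (of_real (r ^ nat \<bar>m\<bar>) * f r)) = (\<lambda>r. of_real (r ^ nat (\<bar>m\<bar> + 1)) * f r)"
    by (auto simp: fun_eq_iff nat_add_distrib scaleR_conv_of_real mult_ac)
  finally show "(LINT w|disk_measure. ?g w * bergman_kernel z w)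
           = 2 * of_int (\<bar>m\<bar> + 1) * angular m z * (LINT r|lborel. of_real (r ^ nat (\<bar>m\<bar> + 1)) * f r)"
    by (simp add: mult_ac)
qed


section \<open>The reproducing property\<close>

lemma integrable_disk_const: "integrable disk_measure (\<lambda>_. c :: 'a :: {banach, second_countable_topology})"
proof (subst disk_measure_borel(1))
  show "integrable lborel (\<lambda>w::complex. indicator (ball 0 1) w *\<^sub>R c)"
    by (intro integrable_indicator) (use emeasure_bounded_finite[OF bounded_ball] in auto)
qed simp

lemma AE_disk_nonzero: "AE w in disk_measure. w \<noteq> 0"
  using AE_disk_radial[of "\<lambda>r. r \<noteq> 0"] by simp

lemma integral_power_indicator:
  assumes "0 < \<rho>"
  shows "(LINT r|lborel. of_real (r ^ k) * (of_real (r ^ l) * of_real (indicator {0<..<\<rho>} r)))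
           = complex_of_real (\<rho> ^ (k + l + 1) / (k + l + 1))"
    and "integrable lborel (\<lambda>r. complex_of_real (r ^ k) * (of_real (r ^ l) * of_real (indicator {0<..<\<rho>} r)))"
proof -
  have "has_bochner_integral lborel (\<lambda>r. r ^ (k + l) * indicator {0..\<rho>} r)
      (\<rho> ^ Suc (k + l) / Suc (k + l) - 0 ^ Suc (k + l) / Suc (k + l))"
    using assms by (intro has_bochner_integral_FTC_Icc_nonneg)
      (auto intro!: derivative_eq_intros simp del: power_Suc)
  then have *: "has_bochner_integral lborel (\<lambda>r. complex_of_real (r ^ (k + l) * indicator {0..\<rho>} r))
      (of_real (\<rho> ^ (k + l + 1) / (k + l + 1)))"
    by (intro has_bochner_integral_of_real) simp
  have ae: "AE r in lborel. complex_of_real (r ^ (k + l) * indicator {0..\<rho>} r)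
        = of_real (r ^ k) * (of_real (r ^ l) * of_real (indicator {0<..<\<rho>} r))"
  proof -
    have "AE r in lborel. r \<noteq> 0 \<and> r \<noteq> \<rho>" by (intro AE_conjI AE_lborel_singleton)
    then show ?thesis by eventually_elim (auto simp: power_add indicator_def)
  qed
  have "has_bochner_integral lborel (\<lambda>r. complex_of_real (r ^ k) * (of_real (r ^ l) * of_real (indicator {0<..<\<rho>} r)))
      (of_real (\<rho> ^ (k + l + 1) / (k + l + 1)))"
    by (rule has_bochner_integral_cong_AE[THEN iffD1, OF _ _ ae *]) auto
  then show "(LINT r|lborel. of_real (r ^ k) * (of_real (r ^ l) * of_real (indicator {0<..<\<rho>} r)))
           = complex_of_real (\<rho> ^ (k + l + 1) / (k + l + 1))"
    and "integrable lborel (\<lambda>r. complex_of_real (r ^ k) * (of_real (r ^ l) * of_real (indicator {0<..<\<rho>} r)))"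
    by (auto simp: has_bochner_integral_iff)
qed

text \<open>On |w| < \<rho> the power series of \<open>F\<close> converges uniformly, so it can be
  integrated termwise. The monomial w^n yields 2(n+1) z^n \<rho>^(2n+2) / (2n+2) = \<rho>^(2n+2)
  z^n, and these terms sum to a dilation of \<open>F\<close>.\<close>

lemma holomorphic_kernel_integral:
  assumes F: "F holomorphic_on ball 0 1" and z: "cmod z < 1" and \<rho>: "0 < \<rho>" "\<rho> < 1"
  shows "integrable disk_measure (\<lambda>w. F w * of_real (indicator {0<..<\<rho>} (cmod w)) * bergman_kernel z w)"
    and "(LINT w|disk_measure. F w * of_real (indicator {0<..<\<rho>} (cmod w)) * bergman_kernel z w)
      = of_real (\<rho>\<^sup>2) * F (of_real (\<rho>\<^sup>2) * z)"
proof -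
  define a where "a n = (deriv ^^ n) F 0 / fact n" for n
  have ser: "(\<lambda>n. a n * w ^ n) sums F w" if "cmod w < 1" for w
    using holomorphic_power_series[OF F, of w] that by (simp add: a_def)
  obtain B where B: "\<And>w. cmod w \<le> 1 \<Longrightarrow> cmod (bergman_kernel z w) \<le> B"
    using bergman_kernel_bounded[OF z] by blast
  define f where "f n r = a n * (of_real (r ^ n) * of_real (indicator {0<..<\<rho>} r))" for n r
  define T where "T n w = f n (cmod w) * angular (int n) (sgn w) * bergman_kernel z w" for n w
  have [measurable]: "f n \<in> borel_measurable borel" for n unfolding f_def[abs_def] by measurable
  have f0: "f n r = 0" if "r \<notin> {0<..<1}" for n r using that \<rho> by (auto simp: f_def indicator_def)
  have fi: "integrable lborel (\<lambda>r. r *\<^sub>R f n r)" for n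
    using integrable_mult_right[OF integral_power_indicator(2)[OF \<rho>(1), of 1 n], of "a n"]
    by (simp add: f_def scaleR_conv_of_real mult_ac)
  have Tint: "integrable disk_measure (T n)" for n
    unfolding T_def[abs_def]
    by (rule integrable_disk_mult_bounded[where B = B, OF integral_bergman_kernel_radial(1)[OF _ f0 fi z]])
      (use B in auto)
  have TI: "(LINT w|disk_measure. T n w) = a n * z ^ n * of_real (\<rho> ^ (2 * n + 2))" for n
  proof -
    have e: "nat (\<bar>int n\<bar> + 1) = n + 1" by simp
    have "(LINT w|disk_measure. T n w) = 2 * of_int (\<bar>int n\<bar> + 1) * angular (int n) z * (LINT r|lborel. of_real (r ^ (n + 1)) * f n r)"
      unfolding T_def using integral_bergman_kernel_radial(2)[OF _ f0 fi z, of n "int n"] e by simp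
    also have "(LINT r|lborel. of_real (r ^ (n + 1)) * f n r) = (LINT r|lborel. a n * (of_real (r ^ (n + 1)) * (of_real (r ^ n) * of_real (indicator {0<..<\<rho>} r))))"
      by (simp add: f_def mult_ac)
    also have "\<dots> = a n * complex_of_real (\<rho> ^ ((n + 1) + n + 1) / real ((n + 1) + n + 1))"
      using integral_power_indicator(1)[OF \<rho>(1), of "n + 1" n] by (simp only: integral_mult_right_zero)
    also have "(n + 1) + n + 1 = 2 * n + 2" by simp
    also have "2 * of_int (\<bar>int n\<bar> + 1) * angular (int n) z * (a n * complex_of_real (\<rho> ^ (2 * n + 2) / real (2 * n + 2)))
       = a n * z ^ n * of_real (\<rho> ^ (2 * n + 2)) * (2 * of_nat (n + 1) / of_nat (2 * n + 2))"
      by (simp add: add.commute)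
    also have "2 * of_nat (n + 1) / of_nat (2 * n + 2) = (1::complex)"
    proof -
      have "2 * of_nat (n + 1) = (of_nat (2 * n + 2) :: complex)" by simp
      moreover have "(of_nat (2 * n + 2) :: complex) \<noteq> 0" unfolding of_nat_eq_0_iff by simp
      ultimately show ?thesis by (metis divide_self)
    qed
    finally show ?thesis by simp
  qed
  have bnd: "norm (T n w) \<le> cmod (a n * of_real \<rho> ^ n) * B" if w: "w \<in> ball 0 1" for n w
  proof -
    have "cmod (f n (cmod w)) \<le> cmod (a n * of_real \<rho> ^ n)"
      using \<rho> by (auto simp: f_def norm_mult norm_power indicator_def intro!: mult_left_mono power_mono)
    moreover have "cmod (angular (int n) (sgn w)) \<le> 1" by (simp add: norm_power norm_sgn power_0_left)
    ultimately have "cmod (f n (cmod w)) * cmod (angular (int n) (sgn w)) \<le> cmod (a n * of_real \<rho> ^ n) * 1"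
      by (intro mult_mono) auto
    then show ?thesis unfolding T_def norm_mult[of _ "bergman_kernel z w"] 
      using w by (intro mult_mono B) (auto simp: norm_mult)
  qed
  have sum: "summable (\<lambda>n. cmod (a n * of_real \<rho> ^ n) * B)"
  proof (rule summable_mult2, rule powser_insidea)
    \<comment> \<open>An intermediate radius: convergence at \<sigma> gives absolute convergence at
      the smaller \<rho>.\<close>
    define \<sigma> where "\<sigma> = (1 + \<rho>) / 2"
    have \<sigma>: "\<rho> < \<sigma>" "\<sigma> < 1" "0 < \<sigma>" using \<rho> by (auto simp: \<sigma>_def)
    show "summable (\<lambda>n. a n * of_real \<sigma> ^ n)"
      using ser[of "of_real \<sigma>"] \<sigma> by (auto simp: sums_iff)
    show "cmod (of_real \<rho>) < cmod (of_real \<sigma>)" using \<rho> \<sigma> by simp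
  qed
  have s1: "AE w in disk_measure. summable (\<lambda>n. norm (T n w))"
    by (rule AE_I2, rule summable_comparison_test'[where N = 0, OF sum]) (use bnd in auto)
  have s2: "summable (\<lambda>n. LINT w|disk_measure. norm (T n w))"
  proof (rule summable_comparison_test'[where N = 0, OF summable_mult2[OF sum]])
    fix n :: nat
    have "(LINT w|disk_measure. norm (T n w)) \<le> (LINT w|disk_measure. cmod (a n * of_real \<rho> ^ n) * B)"
      using bnd Tint by (intro integral_mono integrable_disk_const) auto
    then show "norm (LINT w|disk_measure. norm (T n w)) \<le> (cmod (a n * of_real \<rho> ^ n) * B) * measure disk_measure (ball 0 1)"
      by (simp add: mult_ac)
  qed
  have eq: "AE w in disk_measure. (\<Sum>n. T n w) = F w * of_real (indicator {0<..<\<rho>} (cmod w)) * bergman_kernel z w"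
    using AE_disk_nonzero AE_space
  proof eventually_elim
    fix w :: complex assume w: "w \<noteq> 0" "w \<in> space disk_measure"
    have "T n w = (a n * w ^ n) * (of_real (indicator {0<..<\<rho>} (cmod w)) * bergman_kernel z w)" for n
      using angular_polar[of "int n" w] by (simp add: T_def f_def mult_ac)
    then have "(\<lambda>n. T n w) sums (F w * (of_real (indicator {0<..<\<rho>} (cmod w)) * bergman_kernel z w))"
      using w by (auto intro!: sums_mult2 ser)
    then show "(\<Sum>n. T n w) = F w * of_real (indicator {0<..<\<rho>} (cmod w)) * bergman_kernel z w"
      by (simp add: sums_iff mult.assoc)
  qed
  have Fm: "F \<in> borel_measurable disk_measure"
    using continuous_imp_measurable_on_sets_lebesgue[OF holomorphic_on_imp_continuous_on[OF F]]
    by (simp add: disk_measure_def)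
  have m: "(\<lambda>w. F w * of_real (indicator {0<..<\<rho>} (cmod w)) * bergman_kernel z w) \<in> borel_measurable disk_measure"
    by (rule borel_measurable_times[OF borel_measurable_times[OF Fm borel_measurable_disk_measure] borel_measurable_disk_measure]) auto
  show "integrable disk_measure (\<lambda>w. F w * of_real (indicator {0<..<\<rho>} (cmod w)) * bergman_kernel z w)"
    by (rule integrable_cong_AE_imp[OF integrable_suminf[OF Tint s1 s2] m]) (use eq in \<open>auto elim!: eventually_mono\<close>)
  have "(\<lambda>n. LINT w|disk_measure. T n w) sums (LINT w|disk_measure. (\<Sum>n. T n w))"
    by (rule sums_integral[OF Tint s1 s2])
  moreover have "(LINT w|disk_measure. (\<Sum>n. T n w)) = (LINT w|disk_measure. F w * of_real (indicator {0<..<\<rho>} (cmod w)) * bergman_kernel z w)"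
    using integrable_suminf[OF Tint s1 s2] by (intro integral_cong_AE m eq) auto
  moreover have "(\<lambda>n. LINT w|disk_measure. T n w) sums (of_real (\<rho>\<^sup>2) * F (of_real (\<rho>\<^sup>2) * z))"
  proof -
    have "cmod (of_real (\<rho>\<^sup>2) * z) < 1"
      using mult_mono[of "\<rho>\<^sup>2" 1 "cmod z" "cmod z"] \<rho> z by (auto simp: norm_mult norm_power power_le_one)
    from sums_mult[OF ser[OF this], of "of_real (\<rho>\<^sup>2)"]
    have "(\<lambda>n. of_real (\<rho>\<^sup>2) * (a n * (of_real (\<rho>\<^sup>2) * z) ^ n)) sums (of_real (\<rho>\<^sup>2) * F (of_real (\<rho>\<^sup>2) * z))" .
    moreover have "a n * z ^ n * of_real (\<rho> ^ (2 * n + 2)) = of_real (\<rho>\<^sup>2) * (a n * (of_real (\<rho>\<^sup>2) * z) ^ n)" for n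
    proof -
      have "\<rho> ^ (2 * n + 2) = \<rho>\<^sup>2 * (\<rho>\<^sup>2) ^ n" unfolding power_add power_mult by (rule mult.commute)
      then show ?thesis by (simp only: power_mult_distrib of_real_mult of_real_power mult_ac)
    qed
    ultimately show ?thesis unfolding TI by (simp only:)
  qed
  ultimately show "(LINT w|disk_measure. F w * of_real (indicator {0<..<\<rho>} (cmod w)) * bergman_kernel z w)
      = of_real (\<rho>\<^sup>2) * F (of_real (\<rho>\<^sup>2) * z)"
    by (metis sums_unique2)
qed

text \<open>Only the sum \<open>u\<close> is known to be integrable, not its holomorphic and
  antiholomorphic parts, so these are integrated over smaller disks of radius
  \<open>\<rho> n\<close>. As the radii tend to 1, dominated convergence handles the integrals of
  \<open>u\<close>, and continuity of \<open>u\<close> at z handles the dilated values.\<close>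

lemma bergman_kernel_reproducing:
  assumes u: "u \<in> harmonic_bergman" and z: "cmod z < 1"
  shows "u z = (LINT w|disk_measure. u w * bergman_kernel z w)"
proof -
  have h: "harmonic_on u (ball 0 1)" and u2: "integrable disk_measure (\<lambda>z. (cmod (u z))\<^sup>2)"
    using u by (auto simp: harmonic_bergman_def)
  obtain F G where FG: "F holomorphic_on ball 0 1" "G holomorphic_on ball 0 1"
    "\<And>w. w \<in> ball 0 1 \<Longrightarrow> u w = F w + cnj (G w)"
    using harmonic_on_decompose[OF h] by blast
  have cu: "continuous_on (ball 0 1) u"
    using h unfolding harmonic_on_def
    by (meson continuous_at_imp_continuous_on has_derivative_continuous)
  have um: "u \<in> borel_measurable disk_measure"
    using continuous_imp_measurable_on_sets_lebesgue[OF cu] by (simp add: disk_measure_def)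
  have ui: "integrable disk_measure u"
  proof (rule Bochner_Integration.integrable_bound)
    show "integrable disk_measure (\<lambda>w. 1 + (cmod (u w))\<^sup>2)"
      by (intro Bochner_Integration.integrable_add u2 integrable_disk_const)
    \<comment> \<open>This puts the square integrable \<open>u\<close> into L^1, because constants
      are integrable on the disk.\<close>
    have "x \<le> 1 + x\<^sup>2" for x :: real
    proof -
      have "2 * x \<le> 1 + x\<^sup>2"
        using zero_le_power2[of "x - 1"] by (simp add: power2_eq_square algebra_simps)
      then show ?thesis using zero_le_power2[of x] by linarith
    qed
    then show "AE w in disk_measure. norm (u w) \<le> norm (1 + (cmod (u w))\<^sup>2)"
      by (intro AE_I2) (simp add: abs_of_nonneg add_nonneg_nonneg)
  qed (rule um)
  obtain B where B: "\<And>w. cmod w \<le> 1 \<Longrightarrow> cmod (bergman_kernel z w) \<le> B"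
    using bergman_kernel_bounded[OF z] by blast
  define \<rho> where "\<rho> n = 1 - 1 / real (n + 2)" for n
  have \<rho>: "0 < \<rho> n" "\<rho> n < 1" for n by (auto simp: \<rho>_def)
  have \<rho>1: "\<rho> \<longlonglongrightarrow> 1" unfolding \<rho>_def by real_asymp
  define I where "I n w = u w * of_real (indicator {0<..<\<rho> n} (cmod w)) * bergman_kernel z w" for n w
  have val: "(LINT w|disk_measure. I n w) = of_real ((\<rho> n)\<^sup>2) * u (of_real ((\<rho> n)\<^sup>2) * z)" for n
  proof -
    let ?f = "\<lambda>w. F w * of_real (indicator {0<..<\<rho> n} (cmod w)) * bergman_kernel z w"
    \<comment> \<open>The kernel is real, so the antiholomorphic part contributes the conjugate of
      an integral of holomorphic type.\<close>
    let ?g = "\<lambda>w. G w * of_real (indicator {0<..<\<rho> n} (cmod w)) * bergman_kernel z w"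
    have "(LINT w|disk_measure. I n w) = (LINT w|disk_measure. ?f w + cnj (?g w))"
      by (intro Bochner_Integration.integral_cong) (auto simp: I_def FG cnj_bergman_kernel algebra_simps)
    also have "\<dots> = (LINT w|disk_measure. ?f w) + (LINT w|disk_measure. cnj (?g w))"
      by (intro Bochner_Integration.integral_add integrable_cnj holomorphic_kernel_integral FG z \<rho>)
    also have "(LINT w|disk_measure. cnj (?g w)) = cnj (LINT w|disk_measure. ?g w)"
      by (rule Bochner_Integration.integral_cnj)
    also have "(LINT w|disk_measure. ?f w) = of_real ((\<rho> n)\<^sup>2) * F (of_real ((\<rho> n)\<^sup>2) * z)"
      by (rule holomorphic_kernel_integral(2)[OF FG(1) z \<rho>])
    also have "(LINT w|disk_measure. ?g w) = of_real ((\<rho> n)\<^sup>2) * G (of_real ((\<rho> n)\<^sup>2) * z)"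
      by (rule holomorphic_kernel_integral(2)[OF FG(2) z \<rho>])
    finally have "(LINT w|disk_measure. I n w) = of_real ((\<rho> n)\<^sup>2) * (F (of_real ((\<rho> n)\<^sup>2) * z) + cnj (G (of_real ((\<rho> n)\<^sup>2) * z)))"
      by (simp add: algebra_simps)
    moreover have "cmod (of_real ((\<rho> n)\<^sup>2) * z) < 1"
      using mult_mono[of "(\<rho> n)\<^sup>2" 1 "cmod z" "cmod z"] \<rho>[of n] z by (auto simp: norm_mult norm_power power_le_one)
    ultimately show ?thesis using FG(3)[of "of_real ((\<rho> n)\<^sup>2) * z"] by simp
  qed
  have Km: "bergman_kernel z \<in> borel_measurable disk_measure"
    by (intro borel_measurable_disk_measure) simp
  have "(\<lambda>n. LINT w|disk_measure. I n w) \<longlonglongrightarrow> (LINT w|disk_measure. u w * bergman_kernel z w)"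
  proof (rule integral_dominated_convergence[where w = "\<lambda>w. cmod (u w) * B"])
    show "(\<lambda>w. u w * bergman_kernel z w) \<in> borel_measurable disk_measure" using um Km by (rule borel_measurable_times)
    show "I n \<in> borel_measurable disk_measure" for n
      unfolding I_def[abs_def]
      by (rule borel_measurable_times[OF borel_measurable_times[OF um borel_measurable_disk_measure] Km]) simp
    show "integrable disk_measure (\<lambda>w. cmod (u w) * B)" using ui by simp
    show "AE w in disk_measure. norm (I n w) \<le> cmod (u w) * B" for n
    proof (rule AE_I2)
      fix w assume "w \<in> space disk_measure"
      then have "cmod (u w * of_real (indicator {0<..<\<rho> n} (cmod w))) * cmod (bergman_kernel z w) \<le> cmod (u w) * B"
        by (intro mult_mono B) (auto simp: norm_mult indicator_def)
      then show "norm (I n w) \<le> cmod (u w) * B" by (simp add: I_def norm_mult)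
    qed
    show "AE w in disk_measure. (\<lambda>n. I n w) \<longlonglongrightarrow> u w * bergman_kernel z w"
      using AE_disk_nonzero AE_space
    proof eventually_elim
      fix w :: complex assume w: "w \<noteq> 0" "w \<in> space disk_measure"
      then have "eventually (\<lambda>n. cmod w < \<rho> n) sequentially"
        using order_tendstoD(1)[OF \<rho>1] by simp
      then have "eventually (\<lambda>n. I n w = u w * bergman_kernel z w) sequentially"
        by eventually_elim (use w in \<open>auto simp: I_def\<close>)
      then show "(\<lambda>n. I n w) \<longlonglongrightarrow> u w * bergman_kernel z w" by (rule tendsto_eventually)
    qed
  qed
  moreover have "(\<lambda>n. LINT w|disk_measure. I n w) \<longlonglongrightarrow> of_real (1\<^sup>2) * u (of_real (1\<^sup>2) * z)"
  proof -
    have "isCont u (of_real (1\<^sup>2) * z)" using cu z by (simp add: continuous_on_eq_continuous_at)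
    then show ?thesis unfolding val
      by (intro tendsto_mult tendsto_of_real tendsto_power \<rho>1 isCont_tendsto_compose[of _ u] tendsto_const)
  qed
  ultimately show ?thesis using LIMSEQ_unique by fastforce
qed

lemma on_disk_bergman_kernel:
  assumes z: "cmod z < 1"
  shows "on_disk (bergman_kernel z) \<in> harmonic_bergman"
proof -
  \<comment> \<open>As a function of w the kernel is \<open>h + cnj (h - 1)\<close> with
    \<open>h\<close> holomorphic, hence harmonic.\<close>
  define h where "h w = 1 / (1 - cnj z * w)\<^sup>2" for w
  have nz: "cnj z * w \<noteq> 1" if "w \<in> ball 0 1" for w
  proof -
    have "cmod (cnj z * w) < 1"
      using mult_mono[of "cmod z" "1" "cmod w" "cmod w"] z that by (auto simp: norm_mult)
    then show "cnj z * w \<noteq> 1" by auto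
  qed
  have "h holomorphic_on ball 0 1"
    unfolding h_def[abs_def] by (intro holomorphic_intros) (use nz in auto)
  then have 1: "harmonic_on h (ball 0 1)" "harmonic_on (\<lambda>w. h w - 1) (ball 0 1)"
    by (auto intro!: harmonic_on_holomorphic holomorphic_intros)
  have "harmonic_on (\<lambda>w. h w + cnj (h w - 1)) (ball 0 1)"
    by (intro harmonic_on_add harmonic_on_cnj 1)
  then have "harmonic_on (on_disk (bergman_kernel z)) (ball 0 1)"
    by (rule harmonic_on_cong[rotated 2]) (auto simp: on_disk_def bergman_kernel_def h_def)
  moreover obtain B where B: "\<And>w. cmod w \<le> 1 \<Longrightarrow> cmod (bergman_kernel z w) \<le> B"
    using bergman_kernel_bounded[OF z] by blast
  have "integrable disk_measure (\<lambda>w. (cmod (on_disk (bergman_kernel z) w))\<^sup>2)"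
  proof (rule Bochner_Integration.integrable_bound[OF integrable_disk_const[of "B\<^sup>2"]])
    show "(\<lambda>w. (cmod (on_disk (bergman_kernel z) w))\<^sup>2) \<in> borel_measurable disk_measure"
      by (subst measurable_cong[where g = "\<lambda>w. (cmod (bergman_kernel z w))\<^sup>2"])
        (auto simp: on_disk_def intro!: borel_measurable_disk_measure)
    show "AE w in disk_measure. norm ((cmod (on_disk (bergman_kernel z) w))\<^sup>2) \<le> norm (B\<^sup>2)"
      using B by (intro AE_I2) (auto simp: on_disk_def intro!: power_mono)
  qed
  ultimately show ?thesis by (auto simp: harmonic_bergman_def on_disk_def)
qed

text \<open>For uniqueness, a competitor \<open>R\<close> is paired with the kernel at w in two
  ways: the kernel reproduces \<open>R\<close> at w, and \<open>R\<close> reproduces the kernel at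
  z. Conjugate symmetry of the pairing identifies the two values. Outside the disk both functions
  are 0 by convention.\<close>

lemma repro_kernel_eq:
  assumes z: "cmod z < 1"
  shows "repro_kernel z = on_disk (bergman_kernel z)"
  unfolding repro_kernel_def
proof (rule the_equality, intro conjI ballI)
  show "on_disk (bergman_kernel z) \<in> harmonic_bergman" by (rule on_disk_bergman_kernel[OF z])
  have cong: "(LINT w|disk_measure. u w * cnj (on_disk (bergman_kernel x) w)) = (LINT w|disk_measure. u w * bergman_kernel x w)" for u x
    by (intro Bochner_Integration.integral_cong) (auto simp: on_disk_def cnj_bergman_kernel)
  show "u z = (LINT w|disk_measure. u w * cnj (on_disk (bergman_kernel z) w))" if "u \<in> harmonic_bergman" for u
    unfolding cong by (rule bergman_kernel_reproducing[OF that z])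
  fix R assume "R \<in> harmonic_bergman \<and> (\<forall>u\<in>harmonic_bergman. u z = (LINT w|disk_measure. u w * cnj (R w)))"
  then have R: "R \<in> harmonic_bergman" and rep: "\<And>u. u \<in> harmonic_bergman \<Longrightarrow> u z = (LINT w|disk_measure. u w * cnj (R w))"
    by auto
  show "R = on_disk (bergman_kernel z)"
  proof
    fix w
    show "R w = on_disk (bergman_kernel z) w"
    proof (cases "cmod w < 1")
      case True
      have "R w = (LINT x|disk_measure. R x * bergman_kernel w x)"
        by (rule bergman_kernel_reproducing[OF R True])
      also have "\<dots> = (LINT x|disk_measure. cnj (on_disk (bergman_kernel w) x * cnj (R x)))"
        by (intro Bochner_Integration.integral_cong) (auto simp: on_disk_def cnj_bergman_kernel mult.commute)
      also have "\<dots> = cnj (on_disk (bergman_kernel w) z)"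
        unfolding rep[OF on_disk_bergman_kernel[OF True]] by (rule Bochner_Integration.integral_cnj)
      also have "\<dots> = on_disk (bergman_kernel z) w"
        using z True bergman_kernel_sym[of w z] by (simp add: on_disk_def cnj_bergman_kernel)
      finally show ?thesis .
    next
      case False
      then show ?thesis using R by (auto simp: harmonic_bergman_def on_disk_def)
    qed
  qed
qed


subsection \<open>Toeplitz operators on the basis\<close>

definition moment :: "(real \<Rightarrow> complex) \<Rightarrow> nat \<Rightarrow> complex" where
  "moment f k = (LINT r|lborel. of_real (r ^ k) * f r)"

abbreviation basis :: "int \<Rightarrow> complex \<Rightarrow> complex" where
  "basis n \<equiv> on_disk (angular n)"

lemma basis_in_polynomials: "basis n \<in> harmonic_polynomials"
proof -
  define a where "a k = (if n \<ge> 0 \<and> k = nat n then 1 else 0 :: complex)" for k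
  define b where "b k = (if n < 0 \<and> k = nat (- n) then 1 else 0 :: complex)" for k
  have "angular n = (\<lambda>z. \<Sum>k\<le>nat \<bar>n\<bar>. a k * z ^ k + b k * cnj z ^ k)"
  proof (cases "n \<ge> 0")
    case True
    then have "a k * z ^ k + b k * cnj z ^ k = (if k = nat n then z ^ k else 0)" for z k
      by (simp add: a_def b_def)
    then show ?thesis using True by (simp add: angular_def fun_eq_iff)
  next
    case False
    then have "a k * z ^ k + b k * cnj z ^ k = (if k = nat (- n) then cnj z ^ k else 0)" for z k
      by (simp add: a_def b_def)
    then show ?thesis using False by (simp add: angular_def fun_eq_iff)
  qed
  then have "basis n = on_disk (\<lambda>z. \<Sum>k\<le>nat \<bar>n\<bar>. a k * z ^ k + b k * cnj z ^ k)" by (rule arg_cong)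
  then show ?thesis unfolding harmonic_polynomials_def mem_Collect_eq by blast
qed

lemma basis_in_bergman: "basis n \<in> harmonic_bergman"
proof -
  have "harmonic_on (angular n) (ball 0 1)"
    unfolding angular_def[abs_def]
    by (cases "n \<ge> 0") (auto intro!: harmonic_on_holomorphic holomorphic_intros
      harmonic_on_cnj[of "\<lambda>w. w ^ nat (- n)", simplified])
  then have "harmonic_on (basis n) (ball 0 1)"
    by (rule harmonic_on_cong[rotated 2]) (auto simp: on_disk_def)
  moreover have "integrable disk_measure (\<lambda>w. (cmod (basis n w))\<^sup>2)"
  proof (rule Bochner_Integration.integrable_bound[OF integrable_disk_const[of "1::real"]])
    show "(\<lambda>w. (cmod (basis n w))\<^sup>2) \<in> borel_measurable disk_measure"
      by (subst measurable_cong[where g = "\<lambda>w. (cmod (angular n w))\<^sup>2"])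
        (auto simp: on_disk_def intro!: borel_measurable_disk_measure)
    show "AE w in disk_measure. norm ((cmod (basis n w))\<^sup>2) \<le> norm (1::real)"
      by (intro AE_I2) (auto simp: on_disk_def norm_angular intro!: power_le_one)
  qed
  ultimately show ?thesis by (auto simp: harmonic_bergman_def on_disk_def)
qed

text \<open>The symbol times \<open>basis n\<close> has angular degree n + p and radial part r^|n|
  f(r), up to a null set. The exponent of the moment collects r^|n| from the argument, r^|n+p| from
  the kernel and r from the area element.\<close>

lemma toeplitz_pre_basis:
  assumes f[measurable]: "f \<in> borel_measurable borel" and 0: "\<And>r. r \<notin> {0<..<1} \<Longrightarrow> f r = 0"
    and int: "integrable lborel (\<lambda>r. r *\<^sub>R f r)"
    and ae: "AE r in lborel. r \<in> {0<..<1} \<longrightarrow> \<phi> r = f r"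
    and q: "integrable disk_measure (quasihomogeneous p \<phi>)"
  shows "toeplitz_pre (quasihomogeneous p \<phi>) (basis n) =
    (\<lambda>z. 2 * of_int (\<bar>n + p\<bar> + 1) * moment f (nat (\<bar>n\<bar> + \<bar>n + p\<bar> + 1)) * basis (n + p) z)"
proof
  fix z
  show "toeplitz_pre (quasihomogeneous p \<phi>) (basis n) z =
    2 * of_int (\<bar>n + p\<bar> + 1) * moment f (nat (\<bar>n\<bar> + \<bar>n + p\<bar> + 1)) * basis (n + p) z"
  proof (cases "cmod z < 1")
    case True
    define g where "g r = of_real (r ^ nat \<bar>n\<bar>) * f r" for r
    have gm[measurable]: "g \<in> borel_measurable borel" unfolding g_def[abs_def] by measurable
    have g0: "g r = 0" if "r \<notin> {0<..<1}" for r using 0[OF that] by (simp add: g_def)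
    have gi: "integrable lborel (\<lambda>r. r *\<^sub>R g r)"
    proof (rule Bochner_Integration.integrable_bound[OF int])
      show "AE r in lborel. norm (r *\<^sub>R g r) \<le> norm (r *\<^sub>R f r)"
      proof (rule AE_I2)
        fix r :: real
        show "norm (r *\<^sub>R g r) \<le> norm (r *\<^sub>R f r)"
        proof (cases "r \<in> {0<..<1}")
          case True
          then have "r ^ nat \<bar>n\<bar> * cmod (f r) \<le> 1 * cmod (f r)"
            by (intro mult_right_mono power_le_one) auto
          then show ?thesis using True by (simp add: g_def norm_mult norm_power mult_left_mono)
        qed (use g0 in auto)
      qed
    qed measurable
    let ?I = "\<lambda>w. g (cmod w) * angular (n + p) (sgn w) * bergman_kernel z w"
    have "(LINT w|disk_measure. quasihomogeneous p \<phi> w * basis n w * repro_kernel z w) = (LINT w|disk_measure. ?I w)"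
    proof (rule integral_cong_AE)
      have s: "sgn \<in> borel_measurable (borel :: complex measure)"
        unfolding sgn_div_norm[abs_def] by measurable
      show "?I \<in> borel_measurable disk_measure"
        using s by (intro borel_measurable_disk_measure) measurable
      have m: "(\<lambda>w. angular n w * bergman_kernel z w) \<in> borel_measurable disk_measure"
        by (intro borel_measurable_disk_measure) measurable
      have "(\<lambda>w. quasihomogeneous p \<phi> w * (angular n w * bergman_kernel z w)) \<in> borel_measurable disk_measure"
        by (intro borel_measurable_times borel_measurable_integrable[OF q] m)
      then show "(\<lambda>w. quasihomogeneous p \<phi> w * basis n w * repro_kernel z w) \<in> borel_measurable disk_measure"
        by (subst measurable_cong[where g = "\<lambda>w. quasihomogeneous p \<phi> w * (angular n w * bergman_kernel z w)"])
          (auto simp: on_disk_def repro_kernel_eq[OF True])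
      show "AE w in disk_measure. quasihomogeneous p \<phi> w * basis n w * repro_kernel z w = ?I w"
        using AE_disk_nonzero AE_space AE_disk_radial[OF ae]
      proof eventually_elim
        fix w assume w: "w \<noteq> 0" "w \<in> space disk_measure" "\<phi> (cmod w) = f (cmod w)"
        have "cis (of_int p * Arg w) = angular p (sgn w)"
          using w(1) by (simp add: angular_cis[symmetric] cis_Arg)
        then have "quasihomogeneous p \<phi> w * angular n w = f (cmod w) * of_real (cmod w ^ nat \<bar>n\<bar>) * (angular n (sgn w) * angular p (sgn w))"
          unfolding quasihomogeneous_def by (subst angular_polar) (simp add: w(3) mult_ac)
        also have "\<dots> = g (cmod w) * angular (n + p) (sgn w)"
          using angular_add_sgn[OF w(1)] by (simp add: g_def mult_ac)
        finally show "quasihomogeneous p \<phi> w * basis n w * repro_kernel z w = ?I w"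
          using w(2) by (simp add: on_disk_def repro_kernel_eq[OF True])
      qed
    qed
    also have "\<dots> = 2 * of_int (\<bar>n + p\<bar> + 1) * angular (n + p) z * (LINT r|lborel. of_real (r ^ nat (\<bar>n + p\<bar> + 1)) * g r)"
      by (rule integral_bergman_kernel_radial(2)[OF gm g0 gi True])
    also have "(LINT r|lborel. of_real (r ^ nat (\<bar>n + p\<bar> + 1)) * g r) = moment f (nat (\<bar>n\<bar> + \<bar>n + p\<bar> + 1))"
      unfolding moment_def g_def by (intro Bochner_Integration.integral_cong) (auto simp: nat_add_distrib power_add mult_ac)
    finally show ?thesis using True by (simp add: toeplitz_pre_def on_disk_def mult_ac)
  qed (simp add: toeplitz_pre_def on_disk_def)
qed

text \<open>The chosen extension agrees with the integral formula on harmonic polynomials and is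
  linear. The scalar \<open>c\<close> is included because in a composition the outer operator meets
  a multiple of a basis function.\<close>

lemma toeplitz_basis:
  assumes f: "f \<in> borel_measurable borel" "\<And>r. r \<notin> {0<..<1} \<Longrightarrow> f r = 0"
    "integrable lborel (\<lambda>r. r *\<^sub>R f r)" "AE r in lborel. r \<in> {0<..<1} \<longrightarrow> \<phi> r = f r"
    and T: "toeplitz_symbol (quasihomogeneous p \<phi>)"
  shows "toeplitz (quasihomogeneous p \<phi>) (\<lambda>z. c * basis n z) =
    (\<lambda>z. c * (2 * of_int (\<bar>n + p\<bar> + 1) * moment f (nat (\<bar>n\<bar> + \<bar>n + p\<bar> + 1))) * basis (n + p) z)"
proof -
  let ?S = "toeplitz (quasihomogeneous p \<phi>)"
  have ext: "toeplitz_extension (quasihomogeneous p \<phi>) ?S"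
  proof -
    obtain S0 where "toeplitz_extension (quasihomogeneous p \<phi>) S0"
      using T by (auto simp: toeplitz_symbol_def)
    then show ?thesis unfolding toeplitz_def by (rule someI[of "toeplitz_extension (quasihomogeneous p \<phi>)"])
  qed
  have q: "integrable disk_measure (quasihomogeneous p \<phi>)" using T by (simp add: toeplitz_symbol_def)
  have "?S (\<lambda>z. c * basis n z) = (\<lambda>z. c * ?S (basis n) z)"
    using ext basis_in_bergman unfolding toeplitz_extension_def bounded_operator_def by blast
  moreover have "?S (basis n) = toeplitz_pre (quasihomogeneous p \<phi>) (basis n)"
    using ext basis_in_polynomials unfolding toeplitz_extension_def by blast
  ultimately show ?thesis using toeplitz_pre_basis[OF f q, of n] by (simp add: mult_ac)
qed

text \<open>Both compositions bring index n back to n, one through n - p and the other through n +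
  p. The outer operator always contributes the factor 2(|n| + 1), which cancels together with the
  inner 2.\<close>

lemma commuting_moments:
  assumes f: "f \<in> borel_measurable borel" "\<And>r. r \<notin> {0<..<1} \<Longrightarrow> f r = 0"
    "integrable lborel (\<lambda>r. r *\<^sub>R f r)" "AE r in lborel. r \<in> {0<..<1} \<longrightarrow> \<phi> r = f r"
    and g: "g \<in> borel_measurable borel" "\<And>r. r \<notin> {0<..<1} \<Longrightarrow> g r = 0"
    "integrable lborel (\<lambda>r. r *\<^sub>R g r)" "AE r in lborel. r \<in> {0<..<1} \<longrightarrow> \<psi> r = g r"
    and T: "toeplitz_symbol (quasihomogeneous p \<phi>)" "toeplitz_symbol (quasihomogeneous (- p) \<psi>)"
    and comm: "operators_commute (toeplitz (quasihomogeneous p \<phi>)) (toeplitz (quasihomogeneous (- p) \<psi>))"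
  shows "of_int (\<bar>n - p\<bar> + 1) * (moment f (nat (\<bar>n\<bar> + \<bar>n - p\<bar> + 1)) * moment g (nat (\<bar>n\<bar> + \<bar>n - p\<bar> + 1)))
    = of_int (\<bar>n + p\<bar> + 1) * (moment f (nat (\<bar>n\<bar> + \<bar>n + p\<bar> + 1)) * moment g (nat (\<bar>n\<bar> + \<bar>n + p\<bar> + 1)))"
proof -
  let ?S = "toeplitz (quasihomogeneous p \<phi>)" and ?T = "toeplitz (quasihomogeneous (- p) \<psi>)"
  note S = toeplitz_basis[OF f T(1)] and T' = toeplitz_basis[OF g T(2)]
  have comm: "?S (?T (basis n)) = ?T (?S (basis n))"
    using comm basis_in_bergman unfolding operators_commute_def by blast
  define \<alpha> \<beta> where "\<alpha> = 2 * of_int (\<bar>n - p\<bar> + 1) * moment g (nat (\<bar>n\<bar> + \<bar>n - p\<bar> + 1))"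
    and "\<beta> = 2 * of_int (\<bar>n + p\<bar> + 1) * moment f (nat (\<bar>n\<bar> + \<bar>n + p\<bar> + 1))"
  define \<alpha>' \<beta>' where "\<alpha>' = 2 * of_int (\<bar>n\<bar> + 1) * moment f (nat (\<bar>n\<bar> + \<bar>n - p\<bar> + 1))"
    and "\<beta>' = 2 * of_int (\<bar>n\<bar> + 1) * moment g (nat (\<bar>n\<bar> + \<bar>n + p\<bar> + 1))"
  note defs = \<alpha>_def \<beta>_def \<alpha>'_def \<beta>'_def
  have "?T (basis n) = (\<lambda>z. \<alpha> * basis (n - p) z)" "?S (basis n) = (\<lambda>z. \<beta> * basis (n + p) z)"
    using T'[of 1 n] S[of 1 n] by (simp_all add: defs)
  moreover have "?S (\<lambda>z. \<alpha> * basis (n - p) z) = (\<lambda>z. \<alpha> * \<alpha>' * basis n z)"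
    using S[of \<alpha> "n - p"] by (simp add: \<alpha>'_def add.commute)
  moreover have "?T (\<lambda>z. \<beta> * basis (n + p) z) = (\<lambda>z. \<beta> * \<beta>' * basis n z)"
    using T'[of \<beta> "n + p"] by (simp add: \<beta>'_def add.commute)
  \<comment> \<open>The point 1/2 lies in the disk and is a zero of no basis function, so the
    coefficients can be compared there.\<close>
  ultimately have "\<alpha> * \<alpha>' * basis n (1/2) = \<beta> * \<beta>' * basis n (1/2)"
    using comm by (metis (no_types, lifting))
  moreover have "basis n (1/2) \<noteq> 0" by (simp add: on_disk_def angular_def)
  ultimately have "\<alpha> * \<alpha>' = \<beta> * \<beta>'" by simp
  moreover have "of_int (\<bar>n\<bar> + 1) \<noteq> (0 :: complex)" unfolding of_int_eq_0_iff by simp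
  ultimately show ?thesis by (simp del: of_int_add add: defs mult_ac)
qed


subsection \<open>Moments and the Mellin transform\<close>

text \<open>The positive and negative parts of \<open>G\<close> are densities of two measures that
  are finite and equal on all half-lines. Hence the measures coincide, the parts agree almost
  everywhere, and their difference vanishes.\<close>

lemma AE_eq_0_if_Ioi_integrals_0_real:
  fixes G :: "real \<Rightarrow> real"
  assumes int: "integrable lborel G" and 0: "\<And>a. (LINT r|lborel. indicator {a<..} r * G r) = 0"
  shows "AE r in lborel. G r = 0"
proof -
  have [measurable]: "G \<in> borel_measurable borel" using int by auto
  define p n where "p r = max 0 (G r)" and "n r = max 0 (- G r)" for r
  have pn: "integrable lborel p" "integrable lborel n" unfolding p_def[abs_def] n_def[abs_def] using int by auto
  have [measurable]: "p \<in> borel_measurable borel" "n \<in> borel_measurable borel"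
    unfolding p_def[abs_def] n_def[abs_def] by measurable
  have em: "emeasure (density lborel (\<lambda>r. ennreal (h r))) {a<..} = ennreal (LINT r|lborel. indicator {a<..} r * h r)"
    if h: "integrable lborel h" "\<And>r. h r \<ge> 0" for h :: "real \<Rightarrow> real" and a
  proof -
    have "emeasure (density lborel (\<lambda>r. ennreal (h r))) {a<..} = (\<integral>\<^sup>+r. ennreal (h r) * indicator {a<..} r \<partial>lborel)"
    proof -
      have [measurable]: "h \<in> borel_measurable borel" using h by auto
      show ?thesis by (intro emeasure_density) measurable
    qed
    also have "\<dots> = (\<integral>\<^sup>+r. ennreal (indicator {a<..} r * h r) \<partial>lborel)"
      by (intro nn_integral_cong) (auto simp: indicator_def)
    also have "\<dots> = ennreal (LINT r|lborel. indicator {a<..} r * h r)"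
      using h integrable_mult_indicator[of "{a<..}" lborel h] by (intro nn_integral_eq_integral) auto
    finally show ?thesis .
  qed
  have "density lborel (\<lambda>r. ennreal (p r)) = density lborel (\<lambda>r. ennreal (n r))"
  proof (rule measure_eqI_lessThan)
    fix a
    have "(LINT r|lborel. indicator {a<..} r * p r) - (LINT r|lborel. indicator {a<..} r * n r)
        = (LINT r|lborel. indicator {a<..} r * p r - indicator {a<..} r * n r)"
      using integrable_mult_indicator[OF _ pn(1), of "{a<..}"] integrable_mult_indicator[OF _ pn(2), of "{a<..}"]
      by (intro Bochner_Integration.integral_diff[symmetric]) auto
    also have "\<dots> = (LINT r|lborel. indicator {a<..} r * G r)"
      by (intro Bochner_Integration.integral_cong) (auto simp: p_def n_def max_def indicator_def)
    finally have "(LINT r|lborel. indicator {a<..} r * p r) = (LINT r|lborel. indicator {a<..} r * n r)"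
      by (simp add: 0)
    then show "emeasure (density lborel (\<lambda>r. ennreal (p r))) {a<..} = emeasure (density lborel (\<lambda>r. ennreal (n r))) {a<..}"
      by (subst (1 2) em) (auto simp: pn, auto simp: p_def n_def)
    show "emeasure (density lborel (\<lambda>r. ennreal (p r))) {a<..} < \<infinity>"
      by (subst em[OF pn(1)]) (auto simp: p_def)
  qed auto
  then have "AE r in lborel. ennreal (p r) = ennreal (n r)"
    by (subst (asm) sigma_finite_measure.density_unique_iff[OF sigma_finite_lborel]) auto
  then show ?thesis
    by eventually_elim (auto simp: p_def n_def max_def split: if_splits)
qed

lemma AE_eq_0_if_Ioi_integrals_0:
  fixes G :: "real \<Rightarrow> complex"
  assumes int: "integrable lborel G" and 0: "\<And>a. (LINT r|lborel. of_real (indicator {a<..} r) * G r) = 0"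
  shows "AE r in lborel. G r = 0"
proof -
  have i: "integrable lborel (\<lambda>r. of_real (indicator {a<..} r) * G r)" for a
    using integrable_mult_indicator[OF _ int, of "{a<..}"] by (simp add: scaleR_conv_of_real)
  have "(LINT r|lborel. indicator {a<..} r * Re (G r)) = 0" for a
    using arg_cong[OF 0[of a], of Re] integral_Re[OF i[of a]] by simp
  moreover have "(LINT r|lborel. indicator {a<..} r * Im (G r)) = 0" for a
    using arg_cong[OF 0[of a], of Im] integral_Im[OF i[of a]] by simp
  ultimately have "AE r in lborel. Re (G r) = 0" "AE r in lborel. Im (G r) = 0"
    using int by (auto intro!: AE_eq_0_if_Ioi_integrals_0_real integrable_Re integrable_Im)
  then show ?thesis by eventually_elim (simp add: complex_eq_iff)
qed

text \<open>Polynomials in \<open>r ^ q\<close> are dense in the continuous functions on \<open>[0, 1]\<close>.\<close>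

lemma AE_eq_0_if_power_moments_0:
  fixes G :: "real \<Rightarrow> complex"
  assumes int: "integrable lborel G" and supp: "\<And>r. r \<notin> {0<..<1} \<Longrightarrow> G r = 0" and q: "q > 0"
    and 0: "\<And>k. (LINT r|lborel. of_real (r ^ (q * k)) * G r) = 0"
  shows "AE r in lborel. G r = 0"
proof (rule AE_eq_0_if_Ioi_integrals_0[OF int])
  have [measurable]: "G \<in> borel_measurable borel" using int by auto
  have intb: "integrable lborel (\<lambda>r. of_real (h r) * G r)"
    if [measurable]: "h \<in> borel_measurable borel" and "\<And>r. r \<in> {0<..<1} \<Longrightarrow> \<bar>h r\<bar> \<le> B" for h B
  proof (rule Bochner_Integration.integrable_bound)
    show "integrable lborel (\<lambda>r. B * cmod (G r))" using int by simp
    have "\<bar>h r\<bar> * cmod (G r) \<le> \<bar>B\<bar> * cmod (G r)" for r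
      using that(2)[of r] supp[of r] by (cases "r \<in> {0<..<1}") (auto intro!: mult_right_mono)
    then show "AE r in lborel. norm (of_real (h r) * G r) \<le> norm (B * cmod (G r))"
      by (simp add: norm_mult abs_mult)
  qed measurable
  have cont: "(LINT r|lborel. of_real (h r) * G r) = 0" 
    if h: "continuous_on UNIV h" for h :: "real \<Rightarrow> real"
  proof -
    have [measurable]: "h \<in> borel_measurable borel" using h by (rule borel_measurable_continuous_onI)
    \<comment> \<open>A polynomial \<open>P\<close> close to s -> h(root q s) makes
      \<open>P (r ^ q)\<close> close to \<open>h r\<close>, and \<open>P (r ^ q)\<close> involves
      only the powers whose integrals against \<open>G\<close> are zero.\<close>
    have "continuous_on {0..1} (\<lambda>s. h (root q s))"
      by (intro continuous_on_compose2[OF h] continuous_intros) auto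
    have le: "cmod (LINT r|lborel. of_real (h r) * G r) \<le> e * (LINT r|lborel. cmod (G r))" if e: "e > 0" for e
    proof -
      obtain P where P: "real_polynomial_function P" "\<And>x. x \<in> {0..1} \<Longrightarrow> \<bar>h (root q x) - P x\<bar> < e"
        using Stone_Weierstrass_real_polynomial_function[OF compact_Icc \<open>continuous_on {0..1} (\<lambda>s. h (root q s))\<close> e]
        by blast
      obtain a n where a: "P = (\<lambda>x. \<Sum>i\<le>n. a i * x ^ i)"
        using P(1) real_polynomial_function_iff_sum by blast
      have mon: "integrable lborel (\<lambda>r. of_real (r ^ (q * i)) * G r)" for i
        by (rule intb[of _ 1]) (auto intro!: power_le_one simp: power_abs)
      have "(LINT r|lborel. of_real (P (r ^ q)) * G r) = (LINT r|lborel. (\<Sum>i\<le>n. of_real (a i) * (of_real (r ^ (q * i)) * G r)))"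
        by (simp add: a power_mult[symmetric] sum_distrib_right mult.assoc)
      also have "\<dots> = (\<Sum>i\<le>n. LINT r|lborel. of_real (a i) * (of_real (r ^ (q * i)) * G r))"
        by (intro Bochner_Integration.integral_sum integrable_mult_right mon)
      also have "\<dots> = (\<Sum>i\<le>n. of_real (a i) * (LINT r|lborel. of_real (r ^ (q * i)) * G r))"
        by (intro sum.cong refl integral_mult_right_zero)
      also have "\<dots> = 0" by (simp only: 0 mult_zero_right sum.neutral_const)
      finally have P0: "(LINT r|lborel. of_real (P (r ^ q)) * G r) = 0" .
      have [measurable]: "P \<in> borel_measurable borel" unfolding a by measurable
      have close: "\<bar>h r - P (r ^ q)\<bar> \<le> e" if r: "r \<in> {0<..<1}" for r
      proof -
        have "r ^ q \<in> {0..1}" using r by (auto intro!: power_le_one)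
        moreover have "root q (r ^ q) = r" using r q by (simp add: real_root_power_cancel)
        ultimately show ?thesis using P(2)[of "r ^ q"] by simp
      qed
      have i1: "integrable lborel (\<lambda>r. of_real (h r - P (r ^ q)) * G r)"
        using close by (intro intb) auto
      have i2: "integrable lborel (\<lambda>r. of_real (P (r ^ q)) * G r)"
      proof -
        have "integrable lborel (\<lambda>r. \<Sum>i\<le>n. of_real (a i) * (of_real (r ^ (q * i)) * G r))"
          by (intro Bochner_Integration.integrable_sum integrable_mult_right mon)
        then show ?thesis by (simp add: a power_mult[symmetric] sum_distrib_right mult.assoc)
      qed
      have "(LINT r|lborel. of_real (h r) * G r) = (LINT r|lborel. of_real (h r - P (r ^ q)) * G r + of_real (P (r ^ q)) * G r)"
        by (simp add: algebra_simps)
      also have "\<dots> = (LINT r|lborel. of_real (h r - P (r ^ q)) * G r)"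
        using P0 by (subst Bochner_Integration.integral_add[OF i1 i2]) (simp only: add_0_right)
      finally have "cmod (LINT r|lborel. of_real (h r) * G r) \<le> (LINT r|lborel. cmod (of_real (h r - P (r ^ q)) * G r))"
        by (simp only: integral_norm_bound)
      also have "\<dots> \<le> (LINT r|lborel. e * cmod (G r))"
      proof (rule integral_mono)
        show "cmod (of_real (h r - P (r ^ q)) * G r) \<le> e * cmod (G r)" for r
        proof (cases "r \<in> {0<..<1}")
          case True
          then show ?thesis using close[OF True] unfolding norm_mult norm_of_real by (intro mult_right_mono) auto
        qed (use supp in auto)
      qed (use i1 int in auto)
      finally show ?thesis by simp
    qed
    define J where "J = (LINT r|lborel. cmod (G r))"
    have J: "J \<ge> 0" by (simp add: J_def)
    have "cmod (LINT r|lborel. of_real (h r) * G r) \<le> 0"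
    proof (rule field_le_epsilon)
      fix x :: real assume x: "x > 0"
      have "x / (J + 1) * J \<le> x" using J x by (simp add: divide_simps)
      moreover have "cmod (LINT r|lborel. of_real (h r) * G r) \<le> x / (J + 1) * J"
        unfolding J_def by (rule le) (use x J in \<open>auto simp: J_def[symmetric]\<close>)
      ultimately show "cmod (LINT r|lborel. of_real (h r) * G r) \<le> 0 + x" by linarith
    qed
    then show ?thesis by simp
  qed
  fix a :: real
  \<comment> \<open>Continuous ramps rising from 0 at \<open>a\<close> to 1 at a + 1/n; they
    converge pointwise to the indicator of the open half-line.\<close>
  define h where "h n r = min 1 (max 0 (real n * (r - a)))" for n r
  have h0: "(LINT r|lborel. of_real (h n r) * G r) = 0" for n
    by (rule cont) (auto simp: h_def intro!: continuous_intros)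
  have "(\<lambda>n. LINT r|lborel. of_real (h n r) * G r) \<longlonglongrightarrow> (LINT r|lborel. of_real (indicator {a<..} r) * G r)"
  proof (rule integral_dominated_convergence[where w = "\<lambda>r. cmod (G r)"])
    show "AE r in lborel. (\<lambda>n. of_real (h n r) * G r) \<longlonglongrightarrow> of_real (indicator {a<..} r) * G r"
    proof (rule AE_I2)
      fix r
      have "(\<lambda>n. h n r) \<longlonglongrightarrow> indicator {a<..} r"
      proof (cases "r > a")
        case True
        have "h n r = 1" if "n \<ge> nat \<lceil>1 / (r - a)\<rceil>" for n
        proof -
          have "1 / (r - a) \<le> real n" using that by linarith
          then have "1 \<le> real n * (r - a)" using True by (simp add: divide_simps)
          then show ?thesis by (simp add: h_def)
        qed
        then have "eventually (\<lambda>n. h n r = 1) sequentially" unfolding eventually_sequentially by blast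
        then show ?thesis using True by (simp add: tendsto_eventually)
      next
        case False
        then have "h n r = 0" for n by (auto simp: h_def mult_nonneg_nonpos)
        then show ?thesis using False by simp
      qed
      then show "(\<lambda>n. of_real (h n r) * G r) \<longlonglongrightarrow> of_real (indicator {a<..} r) * G r"
        by (intro tendsto_intros)
    qed
    show "AE r in lborel. norm (of_real (h n r) * G r) \<le> cmod (G r)" for n
      by (rule AE_I2) (auto simp: norm_mult h_def intro!: mult_left_le_one_le)
    show "(\<lambda>r. of_real (h n r) * G r) \<in> borel_measurable lborel" for n
      unfolding h_def by measurable
  qed (use int in auto)
  then show "(LINT r|lborel. of_real (indicator {a<..} r) * G r) = 0"
    unfolding h0 using LIMSEQ_unique tendsto_const by blast
qed

text \<open>In the usual normalization this is the Mellin transform at x + 1. Indexing by the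
  exponent makes the values at natural numbers the moments, and real exponents open the way to
  analyticity. It is meant for functions that vanish outside (0,1).\<close>

definition mellin :: "(real \<Rightarrow> complex) \<Rightarrow> real \<Rightarrow> complex" where
  "mellin f x = (LINT r|lborel. of_real (r powr x) * f r)"

lemma integrable_mellin:
  fixes f :: "real \<Rightarrow> complex"
  assumes f: "f \<in> borel_measurable borel" "\<And>r. r \<notin> {0<..<1} \<Longrightarrow> f r = 0" "integrable lborel (\<lambda>r. r *\<^sub>R f r)"
    and x: "x \<ge> 1"
  shows "integrable lborel (\<lambda>r. of_real (r powr x) * f r)"
proof (rule Bochner_Integration.integrable_bound[OF f(3)])
  note [measurable] = f(1)
  show "(\<lambda>r. of_real (r powr x) * f r) \<in> borel_measurable lborel" by measurable
  show "AE r in lborel. norm (of_real (r powr x) * f r) \<le> norm (r *\<^sub>R f r)"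
  proof (rule AE_I2)
    fix r :: real
    show "norm (of_real (r powr x) * f r) \<le> norm (r *\<^sub>R f r)"
    proof (cases "r \<in> {0<..<1}")
      case True
      then have "r powr x \<le> r powr 1" using x by (intro powr_mono') auto
      then show ?thesis using True by (auto simp: norm_mult intro!: mult_right_mono)
    qed (use f(2) in auto)
  qed
qed

lemma moment_eq_mellin:
  assumes "\<And>r. r \<notin> {0<..<1} \<Longrightarrow> f r = 0"
  shows "moment f k = mellin f (real k)"
  unfolding moment_def mellin_def
proof (rule Bochner_Integration.integral_cong[OF refl])
  fix r :: real
  show "of_real (r ^ k) * f r = of_real (r powr real k) * f r"
    using assms[of r] by (cases "r \<in> {0<..<1}") (auto simp: powr_realpow)
qed


section \<open>Mellin convolution of Borel functions\<close>

definition borel_mellin_convolution :: "(real \<Rightarrow> complex) \<Rightarrow> (real \<Rightarrow> complex) \<Rightarrow> real \<Rightarrow> complex" where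
  "borel_mellin_convolution f g r = (LINT t|lborel. f t * g (r / t) * of_real (1 / t))"

lemma borel_mellin_convolution_eq_0:
  assumes "\<And>r. r \<notin> {0<..<1} \<Longrightarrow> f r = 0" "\<And>r. r \<notin> {0<..<1} \<Longrightarrow> g r = 0" "r \<notin> {0<..<1}"
  shows "borel_mellin_convolution f g r = 0"
proof -
  have "f t * g (r / t) * of_real (1 / t) = 0" for t
  proof (cases "t \<in> {0<..<1}")
    case True
    then have "r / t \<notin> {0<..<1}" using assms(3) by (auto simp: divide_simps)
    then show ?thesis using assms(2) by simp
  qed (use assms(1) in simp)
  then show ?thesis unfolding borel_mellin_convolution_def by (simp only: integral_zero)
qed

text \<open>For fixed t in (0,1) the substitution r = t s splits r^x into t^x s^x, while dr = t ds
  cancels the 1/t of the convolution. The same computation with absolute values gives integrability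
  on the product space, so Fubini applies.\<close>

lemma mellin_borel_mellin_convolution:
  assumes f: "f \<in> borel_measurable borel" "\<And>r. r \<notin> {0<..<1} \<Longrightarrow> f r = 0" "integrable lborel (\<lambda>r. r *\<^sub>R f r)"
    and g: "g \<in> borel_measurable borel" "\<And>r. r \<notin> {0<..<1} \<Longrightarrow> g r = 0" "integrable lborel (\<lambda>r. r *\<^sub>R g r)"
    and x: "x \<ge> 1"
  shows "integrable lborel (\<lambda>r. of_real (r powr x) * borel_mellin_convolution f g r)"
    and "mellin (borel_mellin_convolution f g) x = mellin f x * mellin g x"
proof -
  note [measurable] = f(1) g(1)
  define H where "H t r = of_real (r powr x) * (f t * g (r / t) * of_real (1 / t))" for t r
  have Hm: "(\<lambda>(t, r). H t r) \<in> borel_measurable (lborel \<Otimes>\<^sub>M lborel)" unfolding H_def by measurable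
  have mf: "integrable lborel (\<lambda>r. of_real (r powr x) * f r)" by (rule integrable_mellin[OF f x])
  have mg: "integrable lborel (\<lambda>r. of_real (r powr x) * g r)" by (rule integrable_mellin[OF g x])
  have Heq: "H t (0 + t * s) = of_real (1 / t) * ((of_real (t powr x) * f t) * (of_real (s powr x) * g s))" if "t \<in> {0<..<1}" for t s
  proof (cases "s \<in> {0<..<1}")
    case True
    then show ?thesis using that by (simp add: H_def powr_mult)
  next
    case False
    then show ?thesis using that g(2) by (simp add: H_def)
  qed
  have Hint: "integrable lborel (H t)" for t
  proof (cases "t \<in> {0<..<1}")
    case True
    have "integrable lborel (\<lambda>s. H t (0 + t * s))"
      unfolding Heq[OF True] by (intro integrable_mult_right mg)
    then show ?thesis using lborel_integrable_real_affine_iff[of t "H t" 0] True by auto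
  next
    case False
    then show ?thesis using f(2) by (simp add: H_def[abs_def])
  qed
  have Hval: "(LINT r|lborel. H t r) = (of_real (t powr x) * f t) * mellin g x" for t
  proof (cases "t \<in> {0<..<1}")
    case True
    have "(LINT r|lborel. H t r) = \<bar>t\<bar> *\<^sub>R (LINT s|lborel. H t (0 + t * s))"
      by (rule lborel_integral_real_affine) (use True in auto)
    also have "\<dots> = \<bar>t\<bar> *\<^sub>R (of_real (1 / t) * ((of_real (t powr x) * f t) * mellin g x))"
      unfolding Heq[OF True] mellin_def by (simp only: integral_mult_right_zero)
    finally show ?thesis using True by (simp add: scaleR_conv_of_real)
  next
    case False
    then show ?thesis using f(2) by (simp add: H_def)
  qed
  have Hnorm: "(LINT r|lborel. cmod (H t r)) = cmod (of_real (t powr x) * f t) * (LINT s|lborel. cmod (of_real (s powr x) * g s))" for t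
  proof (cases "t \<in> {0<..<1}")
    case True
    have "(LINT r|lborel. cmod (H t r)) = \<bar>t\<bar> *\<^sub>R (LINT s|lborel. cmod (H t (0 + t * s)))"
      by (rule lborel_integral_real_affine) (use True in auto)
    also have "\<dots> = \<bar>t\<bar> *\<^sub>R (cmod (of_real (1 / t)) * (cmod (of_real (t powr x) * f t) * (LINT s|lborel. cmod (of_real (s powr x) * g s))))"
      unfolding Heq[OF True] norm_mult[of "of_real (1 / t)"] norm_mult[of "of_real (t powr x) * f t"]
      by (simp only: integral_mult_right_zero)
    finally show ?thesis using True by (simp add: norm_divide)
  next
    case False
    then show ?thesis using f(2) by (simp add: H_def)
  qed
  have HH: "integrable (lborel \<Otimes>\<^sub>M lborel) (\<lambda>(t, r). H t r)"
    by (rule lborel_pair.Fubini_integrable[OF Hm]) (use mf Hint in \<open>auto simp: Hnorm\<close>)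
  have conv: "(LINT t|lborel. H t r) = of_real (r powr x) * borel_mellin_convolution f g r" for r
    unfolding H_def borel_mellin_convolution_def by (rule integral_mult_right_zero)
  show "integrable lborel (\<lambda>r. of_real (r powr x) * borel_mellin_convolution f g r)"
    using lborel_pair.integrable_fst'[OF lborel_pair.integrable_product_swap[OF HH]] by (simp add: conv)
  have "mellin (borel_mellin_convolution f g) x = (LINT r|lborel. LINT t|lborel. H t r)"
    by (simp add: mellin_def conv)
  also have "\<dots> = (LINT t|lborel. LINT r|lborel. H t r)"
    by (rule lborel_pair.Fubini_integral[OF HH])
  also have "\<dots> = mellin f x * mellin g x"
    unfolding Hval mellin_def by (rule integral_mult_left_zero)
  finally show "mellin (borel_mellin_convolution f g) x = mellin f x * mellin g x" .
qed

text \<open>Equality holds at every r in (0,1), although the symbols agree with their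
  representatives only almost everywhere. The t with r/t in an exceptional null set form the image
  of that set under s -> r/s, and differentiable maps preserve null sets. For t outside [r,1] the
  Borel integrand is 0, so integrating over the line loses nothing.\<close>

lemma mellin_convolution_eq_borel:
  assumes f: "f \<in> borel_measurable borel" "\<And>r. r \<notin> {0<..<1} \<Longrightarrow> f r = 0"
    "AE r in lborel. r \<in> {0<..<1} \<longrightarrow> \<phi> r = f r"
    and g: "g \<in> borel_measurable borel" "\<And>r. r \<notin> {0<..<1} \<Longrightarrow> g r = 0"
    "AE r in lborel. r \<in> {0<..<1} \<longrightarrow> \<psi> r = g r"
    and r: "r \<in> {0<..<1}"
  shows "mellin_convolution \<phi> \<psi> r = borel_mellin_convolution f g r"
proof -
  note [measurable] = f(1) g(1)
  let ?I = "\<lambda>t. f t * g (r / t) * of_real (1 / t)"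
  let ?J = "\<lambda>t. indicator {r..1} t *\<^sub>R (\<phi> t * \<psi> (r / t) * of_real (1 / t))"
  have Im: "?I \<in> borel_measurable lborel" by measurable
  have "AE s in lebesgue. s \<in> {0<..<1} \<longrightarrow> \<psi> s = g s" using g(3) by (simp add: AE_completion_iff)
  then obtain N where N: "N \<in> null_sets lebesgue" "\<And>s. s \<notin> N \<Longrightarrow> s \<in> {0<..<1} \<Longrightarrow> \<psi> s = g s"
    unfolding completion.AE_iff_null_sets by auto
  have "negligible ((\<lambda>s. r / s) ` (N - {0}))"
  proof (rule negligible_differentiable_image_negligible)
    show "negligible (N - {0})" using N(1) by (intro negligible_diff) (simp add: negligible_iff_null_sets)
    show "(\<lambda>s. r / s) differentiable_on (N - {0})"
      unfolding differentiable_on_def by (auto intro!: derivative_intros)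
  qed simp
  then have "AE t in lebesgue. t \<notin> (\<lambda>s. r / s) ` (N - {0})"
    unfolding negligible_iff_null_sets by (rule AE_not_in)
  moreover have "AE t in lebesgue. t \<in> {0<..<1} \<longrightarrow> \<phi> t = f t" using f(3) by (simp add: AE_completion_iff)
  moreover have "AE t in lebesgue. t \<noteq> 0 \<and> t \<noteq> r \<and> t \<noteq> 1"
    unfolding AE_completion_iff by (intro AE_conjI AE_lborel_singleton)
  ultimately have ae: "AE t in lebesgue. ?I t = ?J t"
  proof eventually_elim
    fix t assume t: "t \<notin> (\<lambda>s. r / s) ` (N - {0})" "t \<in> {0<..<1} \<longrightarrow> \<phi> t = f t" "t \<noteq> 0 \<and> t \<noteq> r \<and> t \<noteq> 1"
    show "?I t = ?J t"
    proof (cases "t \<in> {r<..<1}")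
      case True
      have "r / t \<notin> N"
      proof
        assume "r / t \<in> N"
        moreover have "t = r / (r / t)" "r / t \<noteq> 0" using r t(3) by auto
        ultimately show False using t(1) by blast
      qed
      moreover have "r / t \<in> {0<..<1}" using True r by auto
      ultimately have "\<psi> (r / t) = g (r / t)" by (rule N(2))
      then show ?thesis using True r t(2) by simp
    next
      case False
      then have "t \<notin> {r..1}" using t(3) by auto
      moreover have "f t = 0 \<or> g (r / t) = 0"
      proof (cases "t \<in> {0<..<1}")
        case True
        then have "r / t \<notin> {0<..<1}" using False by auto
        then show ?thesis using g(2) by blast
      qed (use f(2) in auto)
      ultimately show ?thesis by auto
    qed
  qed
  have Im': "?I \<in> borel_measurable lebesgue" using measurable_completion[OF Im] .
  \<comment> \<open>Measurability comes from completeness: the integrand equals a measurable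
    function almost everywhere.\<close>
  have Jm: "?J \<in> borel_measurable lebesgue" by (rule borel_measurable_AE[OF Im' ae])
  have "mellin_convolution \<phi> \<psi> r = (LINT t|lebesgue. ?J t)"
    unfolding mellin_convolution_def by (rule integral_restrict_space) auto
  also have "\<dots> = (LINT t|lebesgue. ?I t)"
    by (rule integral_cong_AE[OF Jm Im']) (use ae in \<open>auto elim!: eventually_mono\<close>)
  also have "\<dots> = borel_mellin_convolution f g r"
    unfolding borel_mellin_convolution_def by (rule integral_completion[OF Im])
  finally show ?thesis .
qed

text \<open>Expand \<open>r\<^sup>h = exp (h ln r)\<close> in powers of \<open>h\<close>; for \<open>|h| < N\<close> the terms are dominated by \<open>r |f(r)|\<close>.\<close>

lemma mellin_analytic:
  assumes f: "f \<in> borel_measurable borel" "\<And>r. r \<notin> {0<..<1} \<Longrightarrow> f r = 0" "integrable lborel (\<lambda>r. r *\<^sub>R f r)"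
    and N: "N > 0"
  obtains A where "A holomorphic_on ball 0 N" "\<And>h. \<bar>h\<bar> < N \<Longrightarrow> A (of_real h) = mellin f (N + 1 + h)"
proof -
  note [measurable] = f(1)
  define a where "a k = (LINT r|lborel. of_real (r powr (N + 1) * ln r ^ k / fact k) * f r)" for k
  define A where "A h = (LINT r|lborel. of_real (r powr (N + 1)) * exp (h * of_real (ln r)) * f r)" for h
  have ser: "(\<lambda>k. a k * h ^ k) sums A h" if h: "cmod h < N" for h
  proof -
    define T where "T k r = of_real (r powr (N + 1)) * ((h * of_real (ln r)) ^ k /\<^sub>R fact k) * f r" for k r
    have nT: "cmod (T k r) = r powr (N + 1) * cmod (f r) * ((cmod h * \<bar>ln r\<bar>) ^ k /\<^sub>R fact k)" for k r
      by (simp add: T_def norm_mult norm_power divide_simps)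
    have sT: "(\<lambda>k. cmod (T k r)) sums (r powr (N + 1) * cmod (f r) * exp (cmod h * \<bar>ln r\<bar>))" for r
      unfolding nT by (intro sums_mult exp_converges)
    \<comment> \<open>For 0 < r < 1 the exponential is r^(-|h|), and the remaining exponent N + 1 -
      |h| exceeds 1.\<close>
    have bd: "r powr (N + 1) * cmod (f r) * exp (cmod h * \<bar>ln r\<bar>) \<le> norm (r *\<^sub>R f r)" for r
    proof (cases "r \<in> {0<..<1}")
      case True
      then have "exp (cmod h * \<bar>ln r\<bar>) = r powr (- cmod h)" by (simp add: powr_def)
      then have "r powr (N + 1) * cmod (f r) * exp (cmod h * \<bar>ln r\<bar>) = r powr (N + 1 - cmod h) * cmod (f r)"
        by (simp add: powr_add[symmetric] mult_ac)
      also have "r powr (N + 1 - cmod h) \<le> r powr 1" using True h by (intro powr_mono') auto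
      finally show ?thesis using True by (simp add: mult_right_mono)
    qed (use f(2) in auto)
    have partial: "(\<Sum>k<n. cmod (T k r)) \<le> norm (r *\<^sub>R f r)" for n r
    proof -
      have "(\<Sum>k<n. cmod (T k r)) \<le> (\<Sum>k. cmod (T k r))"
        using sT[of r] by (intro sum_le_suminf) (auto simp: sums_iff)
      also have "\<dots> \<le> norm (r *\<^sub>R f r)" using sT[of r] bd[of r] by (simp add: sums_iff)
      finally show ?thesis .
    qed
    have Tm[measurable]: "T k \<in> borel_measurable borel" for k unfolding T_def[abs_def] by measurable
    have Ti: "integrable lborel (T k)" for k
    proof (rule Bochner_Integration.integrable_bound[OF f(3)])
      show "AE r in lborel. norm (T k r) \<le> norm (r *\<^sub>R f r)"
      proof (rule AE_I2)
        fix r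
        have "norm (T k r) \<le> (\<Sum>i<Suc k. cmod (T i r))" by (simp add: sum_nonneg)
        also have "\<dots> \<le> norm (r *\<^sub>R f r)" by (rule partial)
        finally show "norm (T k r) \<le> norm (r *\<^sub>R f r)" .
      qed
    qed simp
    have "(\<lambda>k. LINT r|lborel. T k r) sums (LINT r|lborel. (\<Sum>k. T k r))"
    proof (rule sums_integral[OF Ti])
      show "AE r in lborel. summable (\<lambda>k. norm (T k r))" using sT by (auto simp: sums_iff)
      show "summable (\<lambda>k. LINT r|lborel. norm (T k r))"
      proof (rule summableI_nonneg_bounded)
        fix n
        have "(\<Sum>k<n. LINT r|lborel. norm (T k r)) = (LINT r|lborel. (\<Sum>k<n. cmod (T k r)))"
          using Ti by (intro Bochner_Integration.integral_sum[symmetric]) auto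
        also have "\<dots> \<le> (LINT r|lborel. norm (r *\<^sub>R f r))"
          using Ti partial by (intro integral_mono integrable_norm[OF f(3)]) auto
        finally show "(\<Sum>k<n. LINT r|lborel. norm (T k r)) \<le> (LINT r|lborel. norm (r *\<^sub>R f r))" .
      qed auto
    qed
    moreover have "(LINT r|lborel. T k r) = a k * h ^ k" for k
    proof -
      have "T k r = h ^ k * (of_real (r powr (N + 1) * ln r ^ k / fact k) * f r)" for r
        by (simp add: T_def power_mult_distrib scaleR_conv_of_real divide_simps)
      then have "(LINT r|lborel. T k r) = h ^ k * a k"
        unfolding a_def by (simp only: integral_mult_right_zero)
      then show ?thesis by (simp add: mult.commute)
    qed
    moreover have "(\<Sum>k. T k r) = of_real (r powr (N + 1)) * exp (h * of_real (ln r)) * f r" for r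
    proof -
      have "(\<lambda>k. T k r) sums (of_real (r powr (N + 1)) * exp (h * of_real (ln r)) * f r)"
        unfolding T_def by (intro sums_mult sums_mult2 exp_converges)
      then show ?thesis by (simp add: sums_iff)
    qed
    ultimately show ?thesis by (simp add: A_def)
  qed
  show ?thesis
  proof (rule that[of A])
    show "A holomorphic_on ball 0 N"
      by (rule power_series_holomorphic[where a = a]) (use ser in auto)
    fix h :: real assume "\<bar>h\<bar> < N"
    show "A (of_real h) = mellin f (N + 1 + h)"
      unfolding A_def mellin_def
    proof (rule Bochner_Integration.integral_cong[OF refl])
      fix r :: real
      show "of_real (r powr (N + 1)) * exp (of_real h * of_real (ln r)) * f r = of_real (r powr (N + 1 + h)) * f r"
      proof (cases "r \<in> {0<..<1}")
        case True
        then have "r powr (N + 1 + h) = r powr (N + 1) * exp (h * ln r)" by (simp add: powr_def exp_add[symmetric] distrib_right)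
        moreover have "exp (complex_of_real h * of_real (ln r)) = of_real (exp (h * ln r))"
          by (metis exp_of_real of_real_mult)
        ultimately show ?thesis by (simp only: of_real_mult)
      qed (use f(2) in auto)
    qed
  qed
qed

text \<open>Around \<open>N + 1\<close> one of the two transforms has infinitely many zeros in \<open>[N + 1, N + 2]\<close>, hence vanishes on
  \<open>(1, 2N + 1)\<close>; a large \<open>N\<close> reaches a nonzero moment of either function.\<close>

lemma mellin_eq_0_cases:
  fixes f g :: "real \<Rightarrow> complex"
  assumes f: "f \<in> borel_measurable borel" "\<And>r. r \<notin> {0<..<1} \<Longrightarrow> f r = 0" "integrable lborel (\<lambda>r. r *\<^sub>R f r)"
    and g: "g \<in> borel_measurable borel" "\<And>r. r \<notin> {0<..<1} \<Longrightarrow> g r = 0" "integrable lborel (\<lambda>r. r *\<^sub>R g r)"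
    and 0: "\<And>x. x \<ge> 1 \<Longrightarrow> mellin f x * mellin g x = 0"
  shows "(AE r in lborel. f r = 0) \<or> (AE r in lborel. g r = 0)"
proof (rule ccontr)
  \<comment> \<open>The exponents start at 2 because the open interval on which vanishing will be
    shown leaves out 1. They are the power moments of r^2 f(r).\<close>
  have nz: "\<exists>k::nat. mellin f (real k + 2) \<noteq> 0"
    if f: "f \<in> borel_measurable borel" "\<And>r. r \<notin> {0<..<1} \<Longrightarrow> f r = 0" "integrable lborel (\<lambda>r. r *\<^sub>R f r)"
      and n: "\<not> (AE r in lborel. f r = 0)" for f :: "real \<Rightarrow> complex"
  proof (rule ccontr)
    assume c: "\<nexists>k::nat. mellin f (real k + 2) \<noteq> 0"
    have "AE r in lborel. of_real (r powr 2) * f r = 0"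
    proof (rule AE_eq_0_if_power_moments_0[where q = 1])
      show "integrable lborel (\<lambda>r. of_real (r powr 2) * f r)" 
        using integrable_mellin[OF f, of 2] one_le_numeral by blast
      fix k :: nat
      have "(LINT r|lborel. of_real (r ^ (1 * k)) * (of_real (r powr 2) * f r)) = mellin f (real k + 2)"
        unfolding mellin_def
      proof (rule Bochner_Integration.integral_cong[OF refl])
        fix r :: real
        show "of_real (r ^ (1 * k)) * (of_real (r powr 2) * f r) = of_real (r powr (real k + 2)) * f r"
          using f(2)[of r] by (cases "r \<in> {0<..<1}") (auto simp: powr_add powr_realpow)
      qed
      then show "(LINT r|lborel. of_real (r ^ (1 * k)) * (of_real (r powr 2) * f r)) = 0" using c by simp
    qed (use f(2) in auto)
    then have "AE r in lborel. f r = 0"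
    proof eventually_elim
      fix r assume "of_real (r powr 2) * f r = 0"
      then show "f r = 0" using f(2)[of r] by (cases "r \<in> {0<..<1}") auto
    qed
    with n show False by blast
  qed
  assume "\<not> ((AE r in lborel. f r = 0) \<or> (AE r in lborel. g r = 0))"
  then obtain k l :: nat where kl: "mellin f (real k + 2) \<noteq> 0" "mellin g (real l + 2) \<noteq> 0"
    using nz[OF f] nz[OF g] by blast
  \<comment> \<open>Relative to the centre N + 1, the exponent k + 2 has offset k + 1 - N = -(l +
    2), which lies within radius N; the same holds with k and l exchanged. Also N > 1 places [0,1]
    inside the disk.\<close>
  define N where "N = real k + real l + 3"
  have N: "N > 0" "N > 1" by (auto simp: N_def)
  obtain A where A: "A holomorphic_on ball 0 N" "\<And>h. \<bar>h\<bar> < N \<Longrightarrow> A (of_real h) = mellin f (N + 1 + h)"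
    using mellin_analytic[OF f N(1)] by blast
  obtain B where B: "B holomorphic_on ball 0 N" "\<And>h. \<bar>h\<bar> < N \<Longrightarrow> B (of_real h) = mellin g (N + 1 + h)"
    using mellin_analytic[OF g N(1)] by blast
  define U where "U C = {z \<in> complex_of_real ` {0..1}. C z = 0}" for C :: "complex \<Rightarrow> complex"
  have "complex_of_real ` {0..1} \<subseteq> U A \<union> U B"
  proof (clarify)
    fix h :: real assume h: "h \<in> {0..1}" "complex_of_real h \<notin> U B"
    have "mellin f (N + 1 + h) * mellin g (N + 1 + h) = 0" using h N by (intro 0) auto
    then have "A (of_real h) * B (of_real h) = 0" using A(2)[of h] B(2)[of h] h N by simp
    then show "complex_of_real h \<in> U A" using h by (auto simp: U_def)
  qed
  moreover have "infinite (complex_of_real ` {0..1})"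
    by (subst finite_image_iff) (auto simp: inj_on_def infinite_Icc)
  ultimately have inf: "infinite (U A) \<or> infinite (U B)" by (meson finite_Un finite_subset)
  have vanish: "C (of_real h) = 0" if C: "C holomorphic_on ball 0 N" "infinite (U C)" "\<bar>h\<bar> < N" for C h
  proof -
    have "compact (complex_of_real ` {0..1})" by (intro compact_continuous_image continuous_intros) auto
    moreover have "U C \<subseteq> complex_of_real ` {0..1}" by (auto simp: U_def)
    ultimately obtain \<xi> where \<xi>: "\<xi> \<in> complex_of_real ` {0..1}" "\<xi> islimpt U C"
      using Heine_Borel_imp_Bolzano_Weierstrass C(2) by blast
    show ?thesis
      by (rule analytic_continuation[OF C(1) open_ball connected_ball _ _ \<xi>(2)])
        (use \<xi>(1) C(3) N in \<open>auto simp: U_def\<close>)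
  qed
  from inf show False
  proof
    assume "infinite (U A)"
    from vanish[OF A(1) this, of "real k + 1 - N"] A(2)[of "real k + 1 - N"] kl(1) show False by (simp add: N_def add.commute)
  next
    assume "infinite (U B)"
    from vanish[OF B(1) this, of "real l + 1 - N"] B(2)[of "real l + 1 - N"] kl(2) show False by (simp add: N_def add.commute)
  qed
qed


subsection \<open>Commuting Toeplitz operators\<close>

text \<open>Multiplying \<open>rec\<close> by j + p + 1 turns its left side into the expression at j
  and its right side into the same expression at j + p.\<close>

lemma moment_recurrence_invariant:
  fixes F :: "nat \<Rightarrow> complex"
  assumes rec: "\<And>j. of_nat (j + 1) * F (p + 2 * j + 1) = of_nat (2 * p + j + 1) * F (3 * p + 2 * j + 1)"
  shows "of_nat ((i + p * k + 1) * (i + p * k + p + 1)) * F (p + 2 * (i + p * k) + 1)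
    = of_nat ((i + 1) * (i + p + 1)) * F (p + 2 * i + 1)"
proof (induction k)
  case (Suc k)
  define j where "j = i + p * k"
  have "of_nat ((j + p + 1) * (j + p + p + 1)) * F (p + 2 * (j + p) + 1)
      = of_nat (j + p + 1) * (of_nat (2 * p + j + 1) * F (3 * p + 2 * j + 1))"
  proof -
    have "j + p + p + 1 = 2 * p + j + 1" "p + 2 * (j + p) + 1 = 3 * p + 2 * j + 1" by simp_all
    then show ?thesis by (simp only: of_nat_mult mult.assoc)
  qed
  also have "\<dots> = of_nat (j + p + 1) * (of_nat (j + 1) * F (p + 2 * j + 1))" by (simp only: rec)
  also have "\<dots> = of_nat ((j + 1) * (j + p + 1)) * F (p + 2 * j + 1)" by (simp only: of_nat_mult mult_ac)
  also have "\<dots> = of_nat ((i + 1) * (i + p + 1)) * F (p + 2 * i + 1)"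
    using Suc.IH by (simp only: j_def)
  finally show ?case by (simp only: j_def mult_Suc_right add_ac)
qed simp

text \<open>The start \<open>i\<close> is arbitrary: the moments in the class of \<open>i\<close>
  modulo p alone determine \<open>P\<close>. Different starts thus give formulas for the same
  function, whose constants can then be compared.\<close>

lemma convolution_from_moments:
  fixes P :: "real \<Rightarrow> complex"
  assumes p: "p > 0" and supp: "\<And>r. r \<notin> {0<..<1} \<Longrightarrow> P r = 0"
    and int: "\<And>x. x \<ge> 1 \<Longrightarrow> integrable lborel (\<lambda>r. of_real (r powr x) * P r)"
    and rec: "\<And>j. of_nat (j + 1) * mellin P (real (p + 2 * j + 1)) = of_nat (2 * p + j + 1) * mellin P (real (3 * p + 2 * j + 1))"
  shows "AE r in lborel. r \<in> {0<..<1} \<longrightarrow>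
    P r = 2 * of_nat ((i + 1) * (i + p + 1)) * mellin P (real (p + 2 * i + 1)) / of_nat p * of_real (1 / r ^ p - r ^ p)"
proof -
  define F where "F k = mellin P (real k)" for k
  have int': "integrable lborel (\<lambda>r. of_real (r ^ k) * P r)" if "k \<ge> 1" for k
  proof -
    have "of_real (r ^ k) * P r = of_real (r powr real k) * P r" for r
      using supp[of r] by (cases "r \<in> {0<..<1}") (auto simp: powr_realpow)
    moreover have "integrable lborel (\<lambda>r. of_real (r powr real k) * P r)" using that by (intro int) simp
    ultimately show ?thesis by (simp only:)
  qed
  have F: "F k = (LINT r|lborel. of_real (r ^ k) * P r)" for k
  proof -
    have "moment P k = mellin P (real k)" by (rule moment_eq_mellin) (rule supp)
    then show ?thesis by (simp only: F_def moment_def)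
  qed
  define h where "h = of_nat ((i + 1) * (i + p + 1)) * F (p + 2 * i + 1)"
  define c where "c = 2 * h / of_nat p"
  let ?ind = "\<lambda>r. complex_of_real (indicator {0<..<1} r)"
  \<comment> \<open>The difference between \<open>P\<close> and its claimed value, times r^(p+2i+1).
    This power clears the pole r^(-p), makes all terms integrable, and sends the moment of order 2pk
    to the exponent p + 2j + 1 of \<open>P\<close> with j = i + pk.\<close>
  define G where "G r = of_real (r ^ (p + 2 * i + 1)) * P r
    - c * (of_real (r ^ (2 * i + 1)) * ?ind r - of_real (r ^ (2 * p + 2 * i + 1)) * ?ind r)" for r
  have e: "of_real (r ^ (2 * p * k)) * G r = of_real (r ^ (p + 2 * (i + p * k) + 1)) * P r
      - c * (of_real (r ^ (2 * p * k)) * (of_real (r ^ (2 * i + 1)) * ?ind r)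
             - of_real (r ^ (2 * p * k)) * (of_real (r ^ (2 * p + 2 * i + 1)) * ?ind r))" for k r
  proof -
    have "p + 2 * (i + p * k) + 1 = 2 * p * k + (p + 2 * i + 1)" by (simp add: algebra_simps)
    then have "r ^ (p + 2 * (i + p * k) + 1) = r ^ (2 * p * k) * r ^ (p + 2 * i + 1)"
      by (simp only: power_add)
    then have "complex_of_real (r ^ (p + 2 * (i + p * k) + 1)) = of_real (r ^ (2 * p * k)) * of_real (r ^ (p + 2 * i + 1))"
      by (simp only: of_real_mult)
    then show ?thesis unfolding G_def by (simp only: right_diff_distrib mult_ac of_real_power)
  qed
  have ii: "integrable lborel (\<lambda>r. complex_of_real (r ^ k) * (of_real (r ^ l) * ?ind r))" for k l
    by (rule integral_power_indicator(2)) simp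
  have "AE r in lborel. G r = 0"
  proof (rule AE_eq_0_if_power_moments_0[where q = "2 * p"])
    show "integrable lborel G"
    proof -
      have "integrable lborel (\<lambda>r. of_real (r ^ l) * ?ind r)" for l using ii[of 0 l] by (simp only: power_0 of_real_1 mult_1)
      then show ?thesis unfolding G_def[abs_def]
        by (intro Bochner_Integration.integrable_diff integrable_mult_right int') (simp_all del: of_real_power power_Suc)
    qed
    show "G r = 0" if "r \<notin> {0<..<1}" for r using supp[OF that] that by (simp add: G_def)
    fix k
    define j where "j = i + p * k"
    have v: "(LINT r|lborel. of_real (r ^ (2 * p * k)) * (of_real (r ^ l) * ?ind r)) = 1 / of_nat (2 * p * k + l + 1)" for l
      using integral_power_indicator(1)[of 1 "2 * p * k" l] by simp
    have "(LINT r|lborel. of_real (r ^ (2 * p * k)) * G r) =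
        (LINT r|lborel. of_real (r ^ (p + 2 * j + 1)) * P r)
      - c * ((LINT r|lborel. of_real (r ^ (2 * p * k)) * (of_real (r ^ (2 * i + 1)) * ?ind r))
             - (LINT r|lborel. of_real (r ^ (2 * p * k)) * (of_real (r ^ (2 * p + 2 * i + 1)) * ?ind r)))"
      unfolding e j_def Bochner_Integration.integral_diff[OF ii ii, symmetric] integral_mult_right_zero[symmetric]
      by (rule Bochner_Integration.integral_diff)
        (intro int' integrable_mult_right Bochner_Integration.integrable_diff ii | simp)+
    also have "\<dots> = F (p + 2 * j + 1) - c * (1 / of_nat (2 * p * k + (2 * i + 1) + 1) - 1 / of_nat (2 * p * k + (2 * p + 2 * i + 1) + 1))"
      by (simp only: v F)
    also have "2 * p * k + (2 * i + 1) + 1 = 2 * (j + 1)" by (simp add: j_def algebra_simps)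
    also have "2 * p * k + (2 * p + 2 * i + 1) + 1 = 2 * (j + p + 1)" by (simp add: j_def algebra_simps)
    also have "F (p + 2 * j + 1) - c * (1 / of_nat (2 * (j + 1)) - 1 / of_nat (2 * (j + p + 1))) = 0"
    proof -
      define x y q :: complex where "x = of_nat (j + 1)" and "y = of_nat (j + p + 1)" and "q = of_nat p"
      have nz: "x \<noteq> 0" "y \<noteq> 0" "q \<noteq> 0" unfolding x_def y_def q_def of_nat_eq_0_iff using p by simp_all
      have yx: "y = x + q" by (simp add: x_def y_def q_def)
      have "of_nat ((j + 1) * (j + p + 1)) * F (p + 2 * j + 1) = h"
        using moment_recurrence_invariant[of F p i k] rec by (simp only: F_def j_def h_def)
      then have xyF: "x * y * F (p + 2 * j + 1) = h" by (simp only: x_def y_def of_nat_mult)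
      have "c * (1 / (2 * x) - 1 / (2 * y)) = h / (x * y)"
        using nz unfolding c_def q_def[symmetric] by (simp add: divide_simps) (simp add: yx algebra_simps)
      moreover have "F (p + 2 * j + 1) = h / (x * y)" using xyF nz by (simp add: divide_simps mult_ac)
      moreover have "of_nat (2 * (j + 1)) = 2 * x" "of_nat (2 * (j + p + 1)) = 2 * y" by (simp_all add: x_def y_def)
      ultimately show ?thesis by (simp only: diff_self)
    qed
    finally show "(LINT r|lborel. of_real (r ^ (2 * p * k)) * G r) = 0" .
  qed (use p in simp)
  then show ?thesis
  proof eventually_elim
    fix r assume G0: "G r = 0"
    show "r \<in> {0<..<1} \<longrightarrow> P r = 2 * of_nat ((i + 1) * (i + p + 1)) * mellin P (real (p + 2 * i + 1)) / of_nat p * of_real (1 / r ^ p - r ^ p)"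
    proof
      assume r: "r \<in> {0<..<1}"
      have "r ^ (p + 2 * i + 1) * (1 / r ^ p - r ^ p) = r ^ (2 * i + 1) - r ^ (2 * p + 2 * i + 1)"
        using r by (simp add: right_diff_distrib power_add mult_2)
      then have "of_real (r ^ (p + 2 * i + 1)) * (c * of_real (1 / r ^ p - r ^ p))
          = c * (complex_of_real (r ^ (2 * i + 1)) - of_real (r ^ (2 * p + 2 * i + 1)))"
        by (metis (no_types, lifting) mult.left_commute of_real_diff of_real_mult)
      then have "of_real (r ^ (p + 2 * i + 1)) * (P r - c * of_real (1 / r ^ p - r ^ p)) = G r"
        using r by (simp add: G_def right_diff_distrib)
      moreover have "complex_of_real (r ^ (p + 2 * i + 1)) \<noteq> 0" using r by simp
      ultimately have "P r = c * of_real (1 / r ^ p - r ^ p)" using G0 by simp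
      then show "P r = 2 * of_nat ((i + 1) * (i + p + 1)) * mellin P (real (p + 2 * i + 1)) / of_nat p * of_real (1 / r ^ p - r ^ p)"
        by (simp only: c_def h_def F_def mult.assoc)
    qed
  qed
qed

lemma AE_lborel_Ioo_ex:
  assumes "AE r in lborel. r \<in> {0<..<1::real} \<longrightarrow> Q r"
  shows "\<exists>r\<in>{0<..<1}. Q r"
proof (rule ccontr)
  assume "\<not> ?thesis"
  then have "AE r in lborel. r \<notin> {0<..<1::real}" using assms by (auto elim!: eventually_mono)
  then have "emeasure lborel {0<..<1::real} = 0"
    using AE_iff_measurable[of "{0<..<1::real}" lborel "\<lambda>r. r \<notin> {0<..<1}"]
    by (simp add: greaterThanLessThan_def greaterThan_def lessThan_def Collect_conj_eq)
  then show False by simp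
qed

theorem theorem3:
  fixes p :: int and \<phi> \<psi> :: "real \<Rightarrow> complex"
  assumes "p > 0"
    and "integrable radial_measure \<phi>" and "integrable radial_measure \<psi>"
    and "\<not> (AE r in radial_measure. \<phi> r = 0)" and "\<not> (AE r in radial_measure. \<psi> r = 0)"
    and "toeplitz_symbol (quasihomogeneous p \<phi>)"
    and "toeplitz_symbol (quasihomogeneous (- p) \<psi>)"
    and "operators_commute (toeplitz (quasihomogeneous p \<phi>))
                           (toeplitz (quasihomogeneous (- p) \<psi>))"
  shows "p = 1 \<and>
    (\<exists>C :: complex. AE r in lebesgue_on {0<..<1}.
       mellin_convolution \<phi> \<psi> r = C * complex_of_real (1 / r - r))"
proof -
  obtain f where "f \<in> borel_measurable borel \<and> (\<forall>r. r \<notin> {0<..<1} \<longrightarrow> f r = 0) \<and>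
    (AE r in lborel. r \<in> {0<..<1} \<longrightarrow> \<phi> r = f r) \<and> integrable lborel (\<lambda>r. r *\<^sub>R f r)"
    using radial_borel_representative[OF assms(2)] by (elim exE)
  then have f: "f \<in> borel_measurable borel" "\<And>r. r \<notin> {0<..<1} \<Longrightarrow> f r = 0"
    "AE r in lborel. r \<in> {0<..<1} \<longrightarrow> \<phi> r = f r" "integrable lborel (\<lambda>r. r *\<^sub>R f r)"
    by simp_all
  obtain g where "g \<in> borel_measurable borel \<and> (\<forall>r. r \<notin> {0<..<1} \<longrightarrow> g r = 0) \<and>
    (AE r in lborel. r \<in> {0<..<1} \<longrightarrow> \<psi> r = g r) \<and> integrable lborel (\<lambda>r. r *\<^sub>R g r)"
    using radial_borel_representative[OF assms(3)] by (elim exE)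
  then have g: "g \<in> borel_measurable borel" "\<And>r. r \<notin> {0<..<1} \<Longrightarrow> g r = 0"
    "AE r in lborel. r \<in> {0<..<1} \<longrightarrow> \<psi> r = g r" "integrable lborel (\<lambda>r. r *\<^sub>R g r)"
    by simp_all
  have f0: "\<not> (AE r in lborel. f r = 0)"
  proof
    assume "AE r in lborel. f r = 0"
    with f(3) have "AE r in lborel. r \<in> {0<..<1} \<longrightarrow> \<phi> r = 0" by eventually_elim auto
    from AE_radial_measureI[OF this] show False using assms(4) by contradiction
  qed
  have g0: "\<not> (AE r in lborel. g r = 0)"
  proof
    assume "AE r in lborel. g r = 0"
    with g(3) have "AE r in lborel. r \<in> {0<..<1} \<longrightarrow> \<psi> r = 0" by eventually_elim auto
    from AE_radial_measureI[OF this] show False using assms(5) by contradiction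
  qed
  define P where "P = borel_mellin_convolution f g"
  have conv: "integrable lborel (\<lambda>r. of_real (r powr x) * P r)" "mellin P x = mellin f x * mellin g x" if "x \<ge> 1" for x
    unfolding P_def
    using mellin_borel_mellin_convolution[OF f(1,2,4) g(1,2,4) that] by simp_all
  have P0: "P r = 0" if "r \<notin> {0<..<1}" for r
    unfolding P_def by (rule borel_mellin_convolution_eq_0[OF f(2) g(2) that])
  define q where "q = nat p"
  have q: "q > 0" "p = int q" using assms(1) by (auto simp: q_def)
  define F where "F k = mellin P (real k)" for k
  have F: "moment f k * moment g k = F k" if "k \<ge> 1" for k
  proof -
    have "moment f k = mellin f (real k)" by (rule moment_eq_mellin) (rule f(2))
    moreover have "moment g k = mellin g (real k)" by (rule moment_eq_mellin) (rule g(2))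
    ultimately show ?thesis using conv(2)[of "real k"] that by (simp add: F_def)
  qed
  have comm: "of_int (\<bar>n - p\<bar> + 1) * (moment f (nat (\<bar>n\<bar> + \<bar>n - p\<bar> + 1)) * moment g (nat (\<bar>n\<bar> + \<bar>n - p\<bar> + 1)))
    = of_int (\<bar>n + p\<bar> + 1) * (moment f (nat (\<bar>n\<bar> + \<bar>n + p\<bar> + 1)) * moment g (nat (\<bar>n\<bar> + \<bar>n + p\<bar> + 1)))" for n
    by (rule commuting_moments[OF f(1,2,4,3) g(1,2,4,3) assms(6-8)])
  have rec: "of_nat (j + 1) * F (q + 2 * j + 1) = of_nat (2 * q + j + 1) * F (3 * q + 2 * j + 1)" for j
  proof -
    \<comment> \<open>With n = p + j and j >= 0, none of n - p, n, n + p is negative, so all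
      absolute values open.\<close>
    have n: "\<bar>int (q + j) - p\<bar> + 1 = int (j + 1)" "nat (\<bar>int (q + j)\<bar> + \<bar>int (q + j) - p\<bar> + 1) = q + 2 * j + 1"
      "\<bar>int (q + j) + p\<bar> + 1 = int (2 * q + j + 1)" "nat (\<bar>int (q + j)\<bar> + \<bar>int (q + j) + p\<bar> + 1) = 3 * q + 2 * j + 1"
      by (simp_all add: q(2) nat_eq_iff)
    show ?thesis using comm[of "int (q + j)"] unfolding n of_int_of_nat_eq by (simp only: F le_add2)
  qed
  have rec1: "of_nat q * F (q + 1) = of_nat (q + 2) * F (q + 3)"
  proof -
    \<comment> \<open>Here |1 - p| = p - 1. For p = 1 the resulting equation is the recurrence at j
      = 0; for larger p it is a new one.\<close>
    have n: "\<bar>1 - p\<bar> + 1 = int q" "nat (\<bar>1\<bar> + \<bar>1 - p\<bar> + 1) = q + 1"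
      "\<bar>1 + p\<bar> + 1 = int (q + 2)" "nat (\<bar>1\<bar> + \<bar>1 + p\<bar> + 1) = q + 3"
      using q by (simp_all add: nat_eq_iff)
    show ?thesis using comm[of 1] unfolding n of_int_of_nat_eq by (simp only: F le_add2)
  qed
  have sol: "AE r in lborel. r \<in> {0<..<1} \<longrightarrow>
    P r = 2 * of_nat ((i + 1) * (i + q + 1)) * F (q + 2 * i + 1) / of_nat q * of_real (1 / r ^ q - r ^ q)" for i
    unfolding F_def using rec[unfolded F_def] by (intro convolution_from_moments q(1) P0 conv(1))
  have q1: "q = 1"
  proof (rule ccontr)
    assume "q \<noteq> 1"
    \<comment> \<open>The starts i = 0 and i = 1 describe the same \<open>P\<close>. A single radius
      at which both formulas hold makes their constants equal, because r^(-q) differs from r^q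
      there.\<close>
    have "AE r in lborel. r \<in> {0<..<1} \<longrightarrow>
      2 * of_nat ((0 + 1) * (0 + q + 1)) * F (q + 2 * 0 + 1) / of_nat q * complex_of_real (1 / r ^ q - r ^ q)
      = 2 * of_nat ((1 + 1) * (1 + q + 1)) * F (q + 2 * 1 + 1) / of_nat q * complex_of_real (1 / r ^ q - r ^ q)"
      using sol[of 0] sol[of 1] by eventually_elim metis
    from AE_lborel_Ioo_ex[OF this] obtain r where r: "r \<in> {0<..<1}"
      "2 * of_nat ((0 + 1) * (0 + q + 1)) * F (q + 2 * 0 + 1) / of_nat q * complex_of_real (1 / r ^ q - r ^ q)
      = 2 * of_nat ((1 + 1) * (1 + q + 1)) * F (q + 2 * 1 + 1) / of_nat q * complex_of_real (1 / r ^ q - r ^ q)"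
      by blast
    have "0 < r ^ q" "r ^ q < 1" using r(1) q(1) by (auto simp: power_less_one_iff)
    then have "1 / r ^ q > 1" by simp
    with \<open>r ^ q < 1\<close> have nz: "complex_of_real (1 / r ^ q - r ^ q) \<noteq> 0"
      by (simp only: of_real_eq_0_iff)
    have "of_nat (q + 1) * F (q + 1) = 2 * (of_nat (q + 2) * F (q + 3))"
    proof -
      have "(of_nat q :: complex) \<noteq> 0" using q(1) by simp
      then have "2 * of_nat ((0 + 1) * (0 + q + 1)) * F (q + 2 * 0 + 1) = 2 * of_nat ((1 + 1) * (1 + q + 1)) * F (q + 2 * 1 + 1)"
        using r(2) unfolding mult_right_cancel[OF nz] by (simp only: divide_cancel_right simp_thms)
      moreover have "(0 + 1) * (0 + q + 1) = q + 1" "q + 2 * 0 + 1 = q + 1" "(1 + 1) * (1 + q + 1) = 2 * (q + 2)" "q + 2 * 1 + 1 = q + 3"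
        by simp_all
      ultimately have "2 * of_nat (q + 1) * F (q + 1) = 2 * of_nat (2 * (q + 2)) * F (q + 3)" by (simp only:)
      then have "2 * (of_nat (q + 1) * F (q + 1)) = 2 * (2 * (of_nat (q + 2) * F (q + 3)))"
        by (simp only: of_nat_mult of_nat_numeral mult.assoc)
      then show ?thesis by (rule mult_left_cancel[THEN iffD1, rotated]) simp
    qed
    then have "of_nat (q + 1) * F (q + 1) = 2 * (of_nat q * F (q + 1))" by (simp only: rec1)
    then have "(of_nat (q + 1) - of_nat (2 * q)) * F (q + 1) = 0" by (simp add: algebra_simps)
    \<comment> \<open>This is the only place where the value of q decides: q + 1 = 2q exactly when q
      = 1.\<close>
    moreover have "of_nat (q + 1) - of_nat (2 * q) \<noteq> (0 :: complex)"
    proof -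
      have "(of_nat (q + 1) :: complex) \<noteq> of_nat (2 * q)" unfolding of_nat_eq_iff using \<open>q \<noteq> 1\<close> by simp
      then show ?thesis by simp
    qed
    ultimately have "F (q + 1) = 0" by simp
    \<comment> \<open>The constant in the formula for i = 0 is a multiple of F(q + 1).\<close>
    then have "AE r in lborel. P r = 0"
      using sol[of 0] P0 by (auto elim!: eventually_mono)
    then have "mellin P x = 0" for x
      unfolding mellin_def by (intro integral_eq_zero_AE) (auto elim!: eventually_mono)
    then have "mellin f x * mellin g x = 0" if "x \<ge> 1" for x
      using conv(2)[OF that] by simp
    then show False
      using mellin_eq_0_cases[OF f(1,2,4) g(1,2,4)] f0 g0 by blast
  qed
  have mc: "mellin_convolution \<phi> \<psi> r = P r" if "r \<in> {0<..<1}" for r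
    unfolding P_def by (rule mellin_convolution_eq_borel[OF f(1-3) g(1-3) that])
  \<comment> \<open>The witness for \<open>C\<close> is the constant of the start i = 0, which for q
    = 1 equals 4 F(2).\<close>
  have "AE r in lebesgue_on {0<..<1}. mellin_convolution \<phi> \<psi> r
      = (2 * of_nat ((0 + 1) * (0 + q + 1)) * F (q + 2 * 0 + 1) / of_nat q) * of_real (1 / r - r)"
  proof -
    have "AE r in lebesgue. r \<in> {0<..<1} \<longrightarrow> mellin_convolution \<phi> \<psi> r
      = (2 * of_nat ((0 + 1) * (0 + q + 1)) * F (q + 2 * 0 + 1) / of_nat q) * of_real (1 / r - r)"
      unfolding AE_completion_iff using sol[of 0]
    proof eventually_elim
      fix r
      assume "r \<in> {0<..<1} \<longrightarrow> P r = 2 * of_nat ((0 + 1) * (0 + q + 1)) * F (q + 2 * 0 + 1) / of_nat q * of_real (1 / r ^ q - r ^ q)"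
      then show "r \<in> {0<..<1} \<longrightarrow> mellin_convolution \<phi> \<psi> r
      = (2 * of_nat ((0 + 1) * (0 + q + 1)) * F (q + 2 * 0 + 1) / of_nat q) * of_real (1 / r - r)"
        using q1 by (simp only: mc power_one_right simp_thms cong: imp_cong)
    qed
    then show ?thesis by (subst AE_restrict_space_iff) auto
  qed
  then show ?thesis using q(2) q1 by auto
qed

end
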